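(* Fix $\delta>0$. For $k,l>0$ let $a=\frac{4k}{l}$, let $u$ be the solution of the initial-value problem $$u_t+2uu_x=u_{xx}, \quad x\in\mathbb{R},\ t\in\mathbb{R}_+, \qquad u|_{t=0} = -4k\tanh(lx),$$ and let $u_\infty(x) = -4k\tanh(4kx)$. There exist $A>0$ and $C>0$ such that for all $a\ge A$, $$\sup_{x\in\mathbb{R}}|u(x,t)-u_\infty(x)| \le \frac{C}{a^{3\delta+\delta^2}t^{1/2}} \quad\text{for all}\quad t\ge T_* := \frac{(1+\delta)^2 a\log(a)}{32k^2}.$$
   Context: The Burgers equation on the line is considered with the shock-type boundary conditions $\lim_{x\to\pm\infty}u(x,t)=\mp 4k$ for $t\in\mathbb{R}_+$. The constants $A$ and $C$ do not depend on $k$ and $l$. *)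

theory Defs
  imports "HOL-Analysis.Analysis"
begin

text \<open>
  Solutions are functions \<open>u x t\<close> of position and time; the values for \<open>t < 0\<close> are irrelevant.
  ``Solution'' means classical solution: the derivatives in the equation exist and are
  continuous for \<open>t > 0\<close>, and \<open>u\<close> is continuous up to \<open>t = 0\<close>, which ties it to
  the initial datum \<open>f\<close>.
\<close>

definition burgers_ivp_solution :: "(real \<Rightarrow> real) \<Rightarrow> (real \<Rightarrow> real \<Rightarrow> real) \<Rightarrow> bool" where
  "burgers_ivp_solution f u \<longleftrightarrow>
     continuous_on (UNIV \<times> {0..}) (\<lambda>(x, t). u x t) \<and>
     (\<forall>x. u x 0 = f x) \<and>
     (\<exists>u\<^sub>t u\<^sub>x u\<^sub>x\<^sub>x.
        continuous_on (UNIV \<times> {0<..}) (\<lambda>(x, t). u\<^sub>t x t) \<and>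
        continuous_on (UNIV \<times> {0<..}) (\<lambda>(x, t). u\<^sub>x x t) \<and>
        continuous_on (UNIV \<times> {0<..}) (\<lambda>(x, t). u\<^sub>x\<^sub>x x t) \<and>
        (\<forall>x. \<forall>t>0.
           ((\<lambda>s. u x s) has_real_derivative u\<^sub>t x t) (at t) \<and>
           ((\<lambda>y. u y t) has_real_derivative u\<^sub>x x t) (at x) \<and>
           ((\<lambda>y. u\<^sub>x y t) has_real_derivative u\<^sub>x\<^sub>x x t) (at x) \<and>
           u\<^sub>t x t + 2 * u x t * u\<^sub>x x t = u\<^sub>x\<^sub>x x t))"

definition shock_boundary_conditions :: "real \<Rightarrow> (real \<Rightarrow> real \<Rightarrow> real) \<Rightarrow> bool" where
  "shock_boundary_conditions k u \<longleftrightarrow>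
     (\<forall>t>0. ((\<lambda>x. u x t) \<longlongrightarrow> - 4 * k) at_top \<and> ((\<lambda>x. u x t) \<longlongrightarrow> 4 * k) at_bot)"

definition u_infinity :: "real \<Rightarrow> real \<Rightarrow> real" where
  "u_infinity k x = - 4 * k * tanh (4 * k * x)"

definition T_star :: "real \<Rightarrow> real \<Rightarrow> real \<Rightarrow> real" where
  "T_star \<delta> k a = (1 + \<delta>)\<^sup>2 * a * ln a / (32 * k\<^sup>2)"

end

theory Submission
  imports Defs
begin

text \<open>
  The Cole--Hopf transform \<open>u = - \<phi>\<^sub>x / \<phi>\<close> turns \<open>u\<close> into a positive solution \<open>\<phi>\<close> of the heat equation, and
  after rescaling to \<open>l = 1\<close> its initial value is \<open>(2 cosh x) powr a\<close>. The usual uniqueness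
  theorems do not apply, as \<open>u\<close> is not assumed bounded uniformly in time, but positive solutions of the heat equation
  obey a comparison principle without any growth condition (Widder). Comparing \<open>\<phi>\<close> and its difference quotients
  with finite sums of exponentials shows that \<open>\<phi>\<close> and \<open>\<phi>\<^sub>x\<close> agree with those of
  \<open>exp (a\<^sup>2 t) (2 cosh (a x))\<close>, the transform of the stationary shock, up to a relative error
  of order \<open>a exp (- 4 (a - 1) t)\<close>, respectively \<open>a\<^sup>2 exp (- 4 (a - 1) t)\<close>; all other exponentials
  in the expansion are negligible once \<open>a exp (- 2 a t)\<close> is small, which is what \<open>t \<ge> T\<^sub>*\<close> ensures.
\<close>

section \<open>Solutions of the heat equation\<close>

text \<open>The exponents of the estimate come from the gap
  \<open>a\<^sup>2 - (a - 2)\<^sup>2 = 4 * (a - 1)\<close> between the squares of the two largest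
  rates in the expansion of \<open>(2 * cosh x) powr a\<close>. In the rescaled time
  \<open>s = l\<^sup>2 * t\<close> the threshold \<open>T_star\<close> reads
  \<open>(1 + \<delta>)\<^sup>2 * ln a / (2 * a)\<close>, and there
  \<open>a * exp (- 2 * a * s)\<close> is \<open>a\<close> to the negative power
  \<open>1 - (1 + \<delta>)\<^sup>2\<close>. Two obstacles shape the argument. For nonintegral
  \<open>a\<close> the binomial series is infinite, and the caloric continuations of its far terms
  outgrow the leading wave; hence only inequalities with finite sums are used. Moreover, comparison
  covers positive solutions only. The derivative of \<open>\<phi>\<close> has no sign, and no global
  bound on \<open>u\<close> is at hand that would make it positive after adding a multiple of
  \<open>\<phi>\<close>; a difference of two translates of \<open>\<phi>\<close> is, by contrast, a
  difference of positive solutions.\<close>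

definition heat_solution :: "(real \<Rightarrow> real \<Rightarrow> real) \<Rightarrow> bool" where
  "heat_solution p \<longleftrightarrow>
     continuous_on (UNIV \<times> {0..}) (\<lambda>(x, t). p x t) \<and>
     (\<exists>p\<^sub>x p\<^sub>x\<^sub>x.
        continuous_on (UNIV \<times> {0<..}) (\<lambda>(x, t). p\<^sub>x x t) \<and>
        continuous_on (UNIV \<times> {0<..}) (\<lambda>(x, t). p\<^sub>x\<^sub>x x t) \<and>
        (\<forall>x. \<forall>t>0.
           (p x has_real_derivative p\<^sub>x\<^sub>x x t) (at t) \<and>
           ((\<lambda>y. p y t) has_real_derivative p\<^sub>x x t) (at x) \<and>
           ((\<lambda>y. p\<^sub>x y t) has_real_derivative p\<^sub>x\<^sub>x x t) (at x)))"

lemma heat_solution_continuous: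
  "heat_solution p \<Longrightarrow> continuous_on (UNIV \<times> {0..}) (\<lambda>(x, t). p x t)"
  by (simp add: heat_solution_def)

lemma heat_solutionI:
  assumes "continuous_on (UNIV \<times> {0..}) (\<lambda>(x, t). p x t)"
    and "continuous_on (UNIV \<times> {0<..}) (\<lambda>(x, t). p\<^sub>x x t)"
    and "continuous_on (UNIV \<times> {0<..}) (\<lambda>(x, t). p\<^sub>x\<^sub>x x t)"
    and "\<And>x t. t > 0 \<Longrightarrow> (p x has_real_derivative p\<^sub>x\<^sub>x x t) (at t)"
    and "\<And>x t. t > 0 \<Longrightarrow> ((\<lambda>y. p y t) has_real_derivative p\<^sub>x x t) (at x)"
    and "\<And>x t. t > 0 \<Longrightarrow> ((\<lambda>y. p\<^sub>x y t) has_real_derivative p\<^sub>x\<^sub>x x t) (at x)"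
  shows "heat_solution p"
  unfolding heat_solution_def using assms by blast

lemma heat_solution_add:
  assumes "heat_solution p" "heat_solution q"
  shows "heat_solution (\<lambda>x t. p x t + q x t)"
proof -
  obtain px pxx where p: "continuous_on (UNIV \<times> {0<..}) (\<lambda>(x, t). px x t)"
      "continuous_on (UNIV \<times> {0<..}) (\<lambda>(x, t). pxx x t)"
      "\<And>x t. t > 0 \<Longrightarrow> (p x has_real_derivative pxx x t) (at t)"
      "\<And>x t. t > 0 \<Longrightarrow> ((\<lambda>y. p y t) has_real_derivative px x t) (at x)"
      "\<And>x t. t > 0 \<Longrightarrow> ((\<lambda>y. px y t) has_real_derivative pxx x t) (at x)"
    using assms(1) unfolding heat_solution_def by blast
  obtain qx qxx where q: "continuous_on (UNIV \<times> {0<..}) (\<lambda>(x, t). qx x t)"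
      "continuous_on (UNIV \<times> {0<..}) (\<lambda>(x, t). qxx x t)"
      "\<And>x t. t > 0 \<Longrightarrow> (q x has_real_derivative qxx x t) (at t)"
      "\<And>x t. t > 0 \<Longrightarrow> ((\<lambda>y. q y t) has_real_derivative qx x t) (at x)"
      "\<And>x t. t > 0 \<Longrightarrow> ((\<lambda>y. qx y t) has_real_derivative qxx x t) (at x)"
    using assms(2) unfolding heat_solution_def by blast
  show ?thesis
  proof (rule heat_solutionI[where p\<^sub>x = "\<lambda>x t. px x t + qx x t" and
        p\<^sub>x\<^sub>x = "\<lambda>x t. pxx x t + qxx x t"])
    show "continuous_on (UNIV \<times> {0..}) (\<lambda>(x, t). p x t + q x t)"
      using continuous_on_add[OF assms[THEN heat_solution_continuous]]
      by (simp add: case_prod_unfold)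
    show "continuous_on (UNIV \<times> {0<..}) (\<lambda>(x, t). px x t + qx x t)"
      using continuous_on_add[OF p(1) q(1)] by (simp add: case_prod_unfold)
    show "continuous_on (UNIV \<times> {0<..}) (\<lambda>(x, t). pxx x t + qxx x t)"
      using continuous_on_add[OF p(2) q(2)] by (simp add: case_prod_unfold)
  qed (auto intro!: DERIV_add p q)
qed

lemma heat_solution_scale:
  assumes "heat_solution p"
  shows "heat_solution (\<lambda>x t. c * p x t)"
proof -
  obtain px pxx where p: "continuous_on (UNIV \<times> {0<..}) (\<lambda>(x, t). px x t)"
      "continuous_on (UNIV \<times> {0<..}) (\<lambda>(x, t). pxx x t)"
      "\<And>x t. t > 0 \<Longrightarrow> (p x has_real_derivative pxx x t) (at t)"
      "\<And>x t. t > 0 \<Longrightarrow> ((\<lambda>y. p y t) has_real_derivative px x t) (at x)"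
      "\<And>x t. t > 0 \<Longrightarrow> ((\<lambda>y. px y t) has_real_derivative pxx x t) (at x)"
    using assms unfolding heat_solution_def by blast
  show ?thesis
  proof (rule heat_solutionI[where p\<^sub>x = "\<lambda>x t. c * px x t" and
        p\<^sub>x\<^sub>x = "\<lambda>x t. c * pxx x t"])
    show "continuous_on (UNIV \<times> {0..}) (\<lambda>(x, t). c * p x t)"
      using continuous_on_mult_left[OF heat_solution_continuous[OF assms], of c]
      by (simp add: case_prod_unfold)
    show "continuous_on (UNIV \<times> {0<..}) (\<lambda>(x, t). c * px x t)"
      using continuous_on_mult_left[OF p(1), of c] by (simp add: case_prod_unfold)
    show "continuous_on (UNIV \<times> {0<..}) (\<lambda>(x, t). c * pxx x t)"
      using continuous_on_mult_left[OF p(2), of c] by (simp add: case_prod_unfold)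
  qed (auto intro!: DERIV_cmult p)
qed

lemma heat_solution_diff:
  assumes "heat_solution p" "heat_solution q"
  shows "heat_solution (\<lambda>x t. p x t - q x t)"
  using heat_solution_add[OF assms(1) heat_solution_scale[OF assms(2), of "-1"]] by simp

lemma heat_solution_exp: "heat_solution (\<lambda>x t. exp (b * x + b\<^sup>2 * t))"
proof (rule heat_solutionI[where p\<^sub>x = "\<lambda>x t. b * exp (b * x + b\<^sup>2 * t)" and
      p\<^sub>x\<^sub>x = "\<lambda>x t. b\<^sup>2 * exp (b * x + b\<^sup>2 * t)"])
qed (auto intro!: continuous_intros derivative_eq_intros simp: case_prod_unfold power2_eq_square)

lemma heat_solution_sum:
  assumes "\<And>i. i \<in> I \<Longrightarrow> heat_solution (p i)"
  shows "heat_solution (\<lambda>x t. \<Sum>i\<in>I. p i x t)"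
proof -
  have "heat_solution (\<lambda>x t. 0)"
    using heat_solution_scale[OF heat_solution_exp, of 0] by simp
  then show ?thesis
    using assms by (induction I rule: infinite_finite_induct) (auto intro!: heat_solution_add)
qed

text \<open>Covers the three symmetries that occur later: reflection (\<open>c = -1\<close>),
  translation (\<open>c = 1\<close>) and the parabolic rescaling to \<open>l = 1\<close>
  (\<open>c = 1 / l\<close>).\<close>

lemma heat_solution_affine:
  assumes "heat_solution p" "c \<noteq> 0"
  shows "heat_solution (\<lambda>x t. p (c * x + d) (c\<^sup>2 * t))"
proof -
  obtain px pxx where p: "continuous_on (UNIV \<times> {0<..}) (\<lambda>(x, t). px x t)"
      "continuous_on (UNIV \<times> {0<..}) (\<lambda>(x, t). pxx x t)"
      "\<And>x t. t > 0 \<Longrightarrow> (p x has_real_derivative pxx x t) (at t)"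
      "\<And>x t. t > 0 \<Longrightarrow> ((\<lambda>y. p y t) has_real_derivative px x t) (at x)"
      "\<And>x t. t > 0 \<Longrightarrow> ((\<lambda>y. px y t) has_real_derivative pxx x t) (at x)"
    using assms unfolding heat_solution_def by blast
  have comp: "continuous_on (UNIV \<times> T) (\<lambda>(x, t). g (c * x + d) (c\<^sup>2 * t))"
    if "continuous_on (UNIV \<times> T) (\<lambda>(x, t). g x t)" "\<And>t. t \<in> T \<Longrightarrow> c\<^sup>2 * t \<in> T"
    for g :: "real \<Rightarrow> real \<Rightarrow> real" and T
  proof -
    have "continuous_on (UNIV \<times> T) (\<lambda>z. (c * fst z + d, c\<^sup>2 * snd z))"
      by (intro continuous_intros)
    then show ?thesis
      using continuous_on_compose2[OF that(1), of "UNIV \<times> T" "\<lambda>z. (c * fst z + d, c\<^sup>2 * snd z)"] that(2)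
      by (force simp: case_prod_unfold)
  qed
  show ?thesis
  proof (rule heat_solutionI[where p\<^sub>x = "\<lambda>x t. c * px (c * x + d) (c\<^sup>2 * t)" and
        p\<^sub>x\<^sub>x = "\<lambda>x t. c\<^sup>2 * pxx (c * x + d) (c\<^sup>2 * t)"])
    show "continuous_on (UNIV \<times> {0..}) (\<lambda>(x, t). p (c * x + d) (c\<^sup>2 * t))"
      by (rule comp[OF heat_solution_continuous[OF assms(1)]]) simp
    have pos: "c\<^sup>2 * t > 0" if "t > 0" for t
      using that assms(2) by simp
    show "continuous_on (UNIV \<times> {0<..}) (\<lambda>(x, t). c * px (c * x + d) (c\<^sup>2 * t))"
      using continuous_on_mult_left[OF comp[OF p(1)], of c] pos by (simp add: case_prod_unfold)
    show "continuous_on (UNIV \<times> {0<..}) (\<lambda>(x, t). c\<^sup>2 * pxx (c * x + d) (c\<^sup>2 * t))"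
      using continuous_on_mult_left[OF comp[OF p(2)], of "c\<^sup>2"] pos by (simp add: case_prod_unfold)
    fix x t :: real assume t: "t > 0"
    show "((\<lambda>t. p (c * x + d) (c\<^sup>2 * t)) has_real_derivative c\<^sup>2 * pxx (c * x + d) (c\<^sup>2 * t)) (at t)"
    proof -
      have "((\<lambda>t. c\<^sup>2 * t) has_real_derivative c\<^sup>2) (at t)"
        by (auto intro!: derivative_eq_intros)
      from DERIV_chain2[of "p (c * x + d)", OF p(3)[OF pos[OF t]] this] show ?thesis
        by (simp add: mult.commute)
    qed
    have lin: "((\<lambda>y. c * y + d) has_real_derivative c) (at x)"
      by (auto intro!: derivative_eq_intros)
    show "((\<lambda>y. p (c * y + d) (c\<^sup>2 * t)) has_real_derivative c * px (c * x + d) (c\<^sup>2 * t)) (at x)"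
      using DERIV_chain2[of "\<lambda>y. p y (c\<^sup>2 * t)", OF p(4)[OF pos[OF t]] lin] by (simp add: mult.commute)
    show "((\<lambda>y. c * px (c * y + d) (c\<^sup>2 * t)) has_real_derivative c\<^sup>2 * pxx (c * x + d) (c\<^sup>2 * t)) (at x)"
      using DERIV_cmult[OF DERIV_chain2[of "\<lambda>y. px y (c\<^sup>2 * t)", OF p(5)[OF pos[OF t]] lin], of c]
      by (simp add: mult_ac power2_eq_square)
  qed
qed

section \<open>Comparison of positive solutions\<close>

text \<open>Adding \<open>e * (t - t0)\<close> makes the differential inequality strict: at a
  negative minimum of the perturbed function, \<open>Ft + e \<le> 0\<close> and
  \<open>Fxx \<ge> 0\<close> contradict \<open>super\<close>. The minimum may lie on the top edge
  \<open>t = T\<close>, so the derivatives are required there too, but the time argument looks only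
  to the left.\<close>

lemma parabolic_minimum_principle:
  fixes F Ft Fx Fxx :: "real \<Rightarrow> real \<Rightarrow> real"
  assumes cont: "continuous_on ({x1..x2} \<times> {t0..T}) (\<lambda>(x, t). F x t)"
    and Ft: "\<And>x t. x1 < x \<Longrightarrow> x < x2 \<Longrightarrow> t0 < t \<Longrightarrow> t \<le> T \<Longrightarrow>
               (F x has_real_derivative Ft x t) (at t)"
    and Fx: "\<And>x t. x1 < x \<Longrightarrow> x < x2 \<Longrightarrow> t0 < t \<Longrightarrow> t \<le> T \<Longrightarrow>
               ((\<lambda>y. F y t) has_real_derivative Fx x t) (at x)"
    and Fxx: "\<And>x t. x1 < x \<Longrightarrow> x < x2 \<Longrightarrow> t0 < t \<Longrightarrow> t \<le> T \<Longrightarrow>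
               ((\<lambda>y. Fx y t) has_real_derivative Fxx x t) (at x)"
    and super: "\<And>x t. x1 < x \<Longrightarrow> x < x2 \<Longrightarrow> t0 < t \<Longrightarrow> t \<le> T \<Longrightarrow> Ft x t - Fxx x t \<ge> 0"
    and bottom: "\<And>x. x1 \<le> x \<Longrightarrow> x \<le> x2 \<Longrightarrow> F x t0 \<ge> 0"
    and left: "\<And>t. t0 \<le> t \<Longrightarrow> t \<le> T \<Longrightarrow> F x1 t \<ge> 0"
    and right: "\<And>t. t0 \<le> t \<Longrightarrow> t \<le> T \<Longrightarrow> F x2 t \<ge> 0"
    and x: "x1 \<le> x" "x \<le> x2" and t: "t0 \<le> t" "t \<le> T"
  shows "F x t \<ge> 0"
proof -
  have pert: "F x t + e * (t - t0) \<ge> 0" if e: "e > 0" for e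
  proof (rule ccontr)
    let ?G = "\<lambda>x t. F x t + e * (t - t0)"
    assume neg: "\<not> ?G x t \<ge> 0"
    have "continuous_on ({x1..x2} \<times> {t0..T}) (\<lambda>z. ?G (fst z) (snd z))"
      using cont by (auto simp: case_prod_unfold intro!: continuous_intros)
    moreover have "compact ({x1..x2} \<times> {t0..T})" "{x1..x2} \<times> {t0..T} \<noteq> {}"
      using x t by (auto intro!: compact_Times)
    ultimately obtain z where z: "z \<in> {x1..x2} \<times> {t0..T}"
        "\<And>w. w \<in> {x1..x2} \<times> {t0..T} \<Longrightarrow> ?G (fst z) (snd z) \<le> ?G (fst w) (snd w)"
      using continuous_attains_inf[of "{x1..x2} \<times> {t0..T}" "\<lambda>z. ?G (fst z) (snd z)"] by blast
    define y s where "y = fst z" and "s = snd z"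
    have ys: "x1 \<le> y" "y \<le> x2" "t0 \<le> s" "s \<le> T"
      using z(1) by (auto simp: y_def s_def mem_Times_iff)
    have min: "?G y s \<le> ?G y' s'" if "x1 \<le> y'" "y' \<le> x2" "t0 \<le> s'" "s' \<le> T" for y' s'
      using z(2)[of "(y', s')"] that by (simp add: y_def s_def)
    have "?G y s < 0"
      using min[OF x t] neg by linarith
    moreover have "e * (s - t0) \<ge> 0"
      using e ys by simp
    ultimately have "F y s < 0"
      by linarith
    then have int: "x1 < y" "y < x2" "t0 < s"
      using bottom[of y] left[of s] right[of s] ys by (force simp: less_eq_real_def)+
    note d = int ys(4)
    have "Fx y s = 0"
    proof (rule DERIV_local_min[OF Fx[OF d]])
      show "0 < min (y - x1) (x2 - y)"
        using int by simp
      show "\<forall>y'. \<bar>y - y'\<bar> < min (y - x1) (x2 - y) \<longrightarrow> F y s \<le> F y' s"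
        using min[of _ s] ys by (auto simp: abs_less_iff)
    qed
    \<comment> \<open>Second derivative test: since \<open>Fx y s = 0\<close>, a negative
      \<open>Fxx\<close> would make \<open>Fx\<close> negative just to the right of
      \<open>y\<close>, so \<open>F\<close> would drop below its minimum.\<close>
    have "Fxx y s \<ge> 0"
    proof (rule ccontr)
      assume "\<not> Fxx y s \<ge> 0"
      then obtain r where r: "r > 0" "\<And>h. 0 < h \<Longrightarrow> h < r \<Longrightarrow> Fx y s > Fx (y + h) s"
        using DERIV_neg_dec_right[OF Fxx[OF d]] by auto
      define h where "h = min (r / 2) ((x2 - y) / 2)"
      have h: "h > 0" "h < r" "y + h < x2"
        using r(1) int by (auto simp: h_def min_def field_simps)
      have "\<exists>z>y. z < y + h \<and> F (y + h) s - F y s = (y + h - y) * Fx z s"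
        by (rule MVT2) (use h int ys(4) in \<open>auto intro!: Fx\<close>)
      then obtain z where z: "y < z" "z < y + h" "F (y + h) s - F y s = h * Fx z s"
        by auto
      have "Fx z s < 0"
        using r(2)[of "z - y"] z(1,2) h \<open>Fx y s = 0\<close> by simp
      then have "F (y + h) s < F y s"
        using z(3) h(1) by (metis diff_less_0_iff_less mult_pos_neg)
      then show False
        using min[of "y + h" s] h ys by simp
    qed
    have "Ft y s + e \<le> 0"
    proof (rule ccontr)
      assume "\<not> Ft y s + e \<le> 0"
      moreover have "(?G y has_real_derivative Ft y s + e) (at s)"
        using Ft[OF d] by (auto intro!: derivative_eq_intros)
      ultimately obtain r where r: "r > 0" "\<And>h. 0 < h \<Longrightarrow> h < r \<Longrightarrow> ?G y (s - h) < ?G y s"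
        using DERIV_pos_inc_left[of "?G y" "Ft y s + e" s] by auto
      define h where "h = min (r / 2) (s - t0)"
      have "0 < h" "h < r" "h \<le> s - t0"
        using r(1) int by (auto simp: h_def min_def)
      then show False
        using r(2)[of h] min[of y "s - h"] ys by simp
    qed
    then show False
      using super[OF d] \<open>Fxx y s \<ge> 0\<close> e by linarith
  qed
  show ?thesis
  proof (rule field_le_epsilon)
    fix e :: real assume e: "e > 0"
    \<comment> \<open>The \<open>+ 1\<close> keeps the denominator positive in the case
      \<open>t = t0\<close>.\<close>
    have "F x t + e / (t - t0 + 1) * (t - t0) \<ge> 0"
      using t e by (intro pert divide_pos_pos) auto
    moreover have "e / (t - t0 + 1) * (t - t0) \<le> e"
      using t e by (simp add: field_simps)
    ultimately show "0 \<le> F x t + e"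
      by linarith
  qed
qed

text \<open>The exponential is a supersolution that is at least 1 at \<open>x = L\<close> and
  \<open>x = - L\<close>. Its constants are fitted to \<open>r = 1 + t / T \<le> 2\<close>: the
  quadratic term of its second space derivative is at most the time derivative of
  \<open>x\<^sup>2 * (1 + t / T)\<close>, and \<open>4 * t\<close> pays for the remaining
  \<open>2 * r\<close>. At fixed \<open>x\<close> it decays like
  \<open>exp (- L\<^sup>2 / (16 * T))\<close>, so \<open>m\<close> may grow with \<open>L\<close> at
  any smaller Gaussian rate. The number \<open>\<kappa>\<close> admits a small defect in the
  differential inequality.\<close>

lemma parabolic_barrier:
  fixes F Ft Fx Fxx :: "real \<Rightarrow> real \<Rightarrow> real"
  assumes T: "0 \<le> t0" "0 < T" and m: "m \<ge> 0"
    and cont: "continuous_on ({-L..L} \<times> {t0..T}) (\<lambda>(x, t). F x t)"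
    and Ft: "\<And>x t. \<bar>x\<bar> < L \<Longrightarrow> t0 < t \<Longrightarrow> t \<le> T \<Longrightarrow> (F x has_real_derivative Ft x t) (at t)"
    and Fx: "\<And>x t. \<bar>x\<bar> < L \<Longrightarrow> t0 < t \<Longrightarrow> t \<le> T \<Longrightarrow>
               ((\<lambda>y. F y t) has_real_derivative Fx x t) (at x)"
    and Fxx: "\<And>x t. \<bar>x\<bar> < L \<Longrightarrow> t0 < t \<Longrightarrow> t \<le> T \<Longrightarrow>
               ((\<lambda>y. Fx y t) has_real_derivative Fxx x t) (at x)"
    and super: "\<And>x t. \<bar>x\<bar> < L \<Longrightarrow> t0 < t \<Longrightarrow> t \<le> T \<Longrightarrow> Ft x t - Fxx x t \<ge> - \<kappa>"
    and bottom: "\<And>x. \<bar>x\<bar> \<le> L \<Longrightarrow> F x t0 \<ge> 0"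
    and sides: "\<And>t. t0 \<le> t \<Longrightarrow> t \<le> T \<Longrightarrow> F (- L) t \<ge> - m" "\<And>t. t0 \<le> t \<Longrightarrow> t \<le> T \<Longrightarrow> F L t \<ge> - m"
    and \<kappa>: "\<kappa> \<ge> 0"
    and x: "\<bar>x\<bar> \<le> L" and t: "t0 \<le> t" "t \<le> T"
  shows "F x t \<ge> - \<kappa> * (t - t0) - m * exp ((x\<^sup>2 * (1 + t / T) + 4 * t - L\<^sup>2) / (16 * T))"
proof -
  define E where "E x t = exp ((x\<^sup>2 * (1 + t / T) + 4 * t - L\<^sup>2) / (16 * T))" for x t
  let ?G = "\<lambda>x t. F x t + \<kappa> * (t - t0) + m * E x t"
  have Epos: "E x t > 0" for x t
    by (simp add: E_def)
  have "?G x t \<ge> 0"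
  proof (rule parabolic_minimum_principle[where ?x1.0 = "-L" and ?x2.0 = L and T = T and F = ?G and
        Ft = "\<lambda>x t. Ft x t + \<kappa> + m * (E x t * ((x\<^sup>2 / T + 4) / (16 * T)))" and
        Fx = "\<lambda>x t. Fx x t + m * (E x t * (2 * x * (1 + t / T) / (16 * T)))" and
        Fxx = "\<lambda>x t. Fxx x t + m * (E x t * (2 * x * (1 + t / T) / (16 * T))\<^sup>2 + E x t * (2 * (1 + t / T) / (16 * T)))"])
    have "continuous_on ({-L..L} \<times> {t0..T}) (\<lambda>z. E (fst z) (snd z))"
      unfolding E_def using T by (intro continuous_intros) auto
    then show "continuous_on ({-L..L} \<times> {t0..T}) (\<lambda>(x, t). ?G x t)"
      using cont by (auto simp: case_prod_unfold intro!: continuous_intros)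
    fix x t assume x: "-L < x" "x < L" and t: "t0 < t" "t \<le> T"
    then have x': "\<bar>x\<bar> < L" by simp
    have "(E x has_real_derivative E x t * ((x\<^sup>2 / T + 4) / (16 * T))) (at t)"
      unfolding E_def using T
      by (auto intro!: derivative_eq_intros simp: field_simps)
    then show "(?G x has_real_derivative Ft x t + \<kappa> + m * (E x t * ((x\<^sup>2 / T + 4) / (16 * T)))) (at t)"
      using Ft[OF x' t] by (auto intro!: derivative_eq_intros)
    have Ex: "((\<lambda>x. E x t) has_real_derivative E x t * (2 * x * (1 + t / T) / (16 * T))) (at x)"
      unfolding E_def using T
      by (auto intro!: derivative_eq_intros)
    then show "((\<lambda>x. ?G x t) has_real_derivative Fx x t + m * (E x t * (2 * x * (1 + t / T) / (16 * T)))) (at x)"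
      using Fx[OF x' t] by (auto intro!: derivative_eq_intros)
    have "((\<lambda>x. E x t * (2 * x * (1 + t / T) / (16 * T))) has_real_derivative
           E x t * (2 * x * (1 + t / T) / (16 * T))\<^sup>2 + E x t * (2 * (1 + t / T) / (16 * T))) (at x)"
    proof -
      have "((\<lambda>x. 2 * x * (1 + t / T) / (16 * T)) has_real_derivative 2 * (1 + t / T) / (16 * T)) (at x)"
        using T by (auto intro!: derivative_eq_intros simp: field_simps)
      from DERIV_mult[OF Ex this] show ?thesis
        by (simp add: power2_eq_square mult_ac)
    qed
    then show "((\<lambda>x. Fx x t + m * (E x t * (2 * x * (1 + t / T) / (16 * T)))) has_real_derivative
        Fxx x t + m * (E x t * (2 * x * (1 + t / T) / (16 * T))\<^sup>2 + E x t * (2 * (1 + t / T) / (16 * T)))) (at x)"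
      by (intro DERIV_add DERIV_cmult Fxx[OF x' t])
    define r where "r = 1 + t / T"
    have r: "0 \<le> r" "r \<le> 2"
      using t T by (auto simp: r_def)
    have "(2 * x * r / (16 * T))\<^sup>2 + 2 * r / (16 * T) \<le> (x\<^sup>2 / T + 4) / (16 * T)"
    proof -
      have "r\<^sup>2 \<le> 2\<^sup>2"
        using r by (intro power_mono)
      then have "x\<^sup>2 * (r\<^sup>2 / 4) \<le> x\<^sup>2 * 1"
        by (intro mult_left_mono) auto
      then have "x\<^sup>2 * (r\<^sup>2 / 4) / T + 2 * r \<le> x\<^sup>2 * 1 / T + 4"
        using T r by (intro add_mono divide_right_mono) auto
      then have "(x\<^sup>2 * (r\<^sup>2 / 4) / T + 2 * r) / (16 * T) \<le> (x\<^sup>2 / T + 4) / (16 * T)"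
        using T by (intro divide_right_mono) auto
      moreover have "(2 * x * r / (16 * T))\<^sup>2 + 2 * r / (16 * T) = (x\<^sup>2 * (r\<^sup>2 / 4) / T + 2 * r) / (16 * T)"
        using T by (simp add: field_simps power2_eq_square)
      ultimately show ?thesis by simp
    qed
    then have "m * (E x t * ((2 * x * r / (16 * T))\<^sup>2 + 2 * r / (16 * T))) \<le> m * (E x t * ((x\<^sup>2 / T + 4) / (16 * T)))"
      using m Epos[of x t] by (intro mult_left_mono) auto
    then show "Ft x t + \<kappa> + m * (E x t * ((x\<^sup>2 / T + 4) / (16 * T))) -
        (Fxx x t + m * (E x t * (2 * x * (1 + t / T) / (16 * T))\<^sup>2 + E x t * (2 * (1 + t / T) / (16 * T)))) \<ge> 0"
      using super[OF x' t] unfolding r_def[symmetric] by (simp add: distrib_left)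
  next
    fix x assume "-L \<le> x" "x \<le> L"
    then show "?G x t0 \<ge> 0"
      using bottom[of x] m Epos[of x t0] by simp
  next
    fix t assume t: "t0 \<le> t" "t \<le> T"
    have "E L t \<ge> 1" "E (- L) t \<ge> 1"
      using T t by (auto simp: E_def distrib_left)
    then have "m * E L t \<ge> m" "m * E (- L) t \<ge> m"
      using m by (simp_all add: mult_le_cancel_left1)
    moreover have "\<kappa> * (t - t0) \<ge> 0"
      using \<kappa> t by simp
    ultimately show "?G (-L) t \<ge> 0" "?G L t \<ge> 0"
      using sides[OF t] by linarith+
  qed (use x t in auto)
  then show ?thesis
    by (simp add: E_def)
qed

section \<open>Time integrals of solutions and their regularity\<close>

lemma continuous_on_curried:
  fixes f :: "'a::topological_space \<Rightarrow> 'b::topological_space \<Rightarrow> 'c::topological_space"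
  assumes "continuous_on (X \<times> Y) (\<lambda>(x, t). f x t)"
    and "continuous_on S g" "continuous_on S h"
    and "\<And>z. z \<in> S \<Longrightarrow> g z \<in> X" "\<And>z. z \<in> S \<Longrightarrow> h z \<in> Y"
  shows "continuous_on S (\<lambda>z. f (g z) (h z))"
proof -
  have "continuous_on S (\<lambda>z. (g z, h z))"
    by (intro continuous_on_Pair assms)
  from continuous_on_compose2[OF assms(1) this] show ?thesis
    using assms(4,5) by auto
qed

text \<open>Trades the moving endpoint for a parameter inside the integrand, so that joint
  continuity of time integrals in \<open>x\<close> and \<open>t\<close> becomes continuity of a
  parameter integral over a fixed interval.\<close>

lemma integral_rescale:
  fixes f :: "real \<Rightarrow> real"
  assumes "continuous_on {0..} f" "t \<ge> 0"
  shows "integral {0..t} f = t * integral {0..1} (\<lambda>r. f (r * t))"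
proof -
  have "((\<lambda>r. t *\<^sub>R f (r * t)) has_integral (integral {0 * t..1 * t} f)) {0..1}"
  proof (rule has_integral_substitution[where c = 0 and d = t])
    show "(\<lambda>r. r * t) ` {0..1} \<subseteq> {0..t}"
      using assms(2) by (auto simp: mult_left_le_one_le)
    show "continuous_on {0..t} f"
      by (rule continuous_on_subset[OF assms(1)]) auto
    show "((\<lambda>r. r * t) has_real_derivative t) (at r within {0..1})" for r
      by (auto intro!: derivative_eq_intros)
  qed (use assms(2) in auto)
  from integral_unique[OF this] show ?thesis
    by simp
qed

lemma continuous_on_time_integral:
  assumes "continuous_on (UNIV \<times> {0..}) (\<lambda>(x, t). p x t)"
  shows "continuous_on (UNIV \<times> {0..}) (\<lambda>(x, t). integral {0..t} (p x :: real \<Rightarrow> real))"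
proof -
  have "continuous_on ((UNIV \<times> {0..}) \<times> cbox 0 1) (\<lambda>(z, r). p (fst z) (r * snd z))"
    unfolding case_prod_unfold
    by (rule continuous_on_curried[OF assms]) (auto intro!: continuous_intros)
  then have "continuous_on (UNIV \<times> {0..}) (\<lambda>z. integral (cbox 0 1) (\<lambda>r. p (fst z) (r * snd z)))"
    by (rule integral_continuous_on_param)
  then have cont: "continuous_on (UNIV \<times> {0..}) (\<lambda>z. snd z * integral {0..1} (\<lambda>r. p (fst z) (r * snd z)))"
    unfolding cbox_interval by (rule continuous_on_mult[OF continuous_on_snd[OF continuous_on_id]])
  have slice: "continuous_on {0..} (p x)" for x
    by (rule continuous_on_curried[OF assms]) auto
  show ?thesis
  proof (rule continuous_on_eq[OF cont])
    show "snd z * integral {0..1} (\<lambda>r. p (fst z) (r * snd z)) = (case z of (x, t) \<Rightarrow> integral {0..t} (p x))"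
      if "z \<in> UNIV \<times> {0..}" for z
      using integral_rescale[OF slice, of "snd z" "fst z"] that by (simp add: case_prod_unfold mem_Times_iff)
  qed
qed

lemma DERIV_integral_upper:
  fixes f :: "real \<Rightarrow> real"
  assumes "continuous_on {0..} f" "t > 0"
  shows "((\<lambda>t. integral {0..t} f) has_real_derivative f t) (at t)"
proof -
  have "((\<lambda>t. integral {0..t} f) has_real_derivative f t) (at t within {0..t + 1})"
    by (rule integral_has_real_derivative[OF continuous_on_subset[OF assms(1)]]) (use assms(2) in auto)
  then show ?thesis
    using assms by (simp add: at_within_Icc_at)
qed

lemma heat_solution_slice:
  assumes "heat_solution p"
  shows "continuous_on {0..} (p x)"
  by (rule continuous_on_curried[OF heat_solution_continuous[OF assms]]) auto

lemma heat_solution_DERIV_time_integral: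
  assumes "heat_solution p" "t > 0"
  shows "((\<lambda>t. integral {0..t} (p x)) has_real_derivative p x t) (at t)"
  using DERIV_integral_upper[OF heat_solution_slice[OF assms(1)] assms(2)] .

lemma integral_diff_initial:
  fixes f :: "real \<Rightarrow> real"
  assumes "continuous_on {0..} f" "0 \<le> s" "s \<le> t"
  shows "integral {0..t} f - integral {0..s} f = integral {s..t} f"
proof -
  have "f integrable_on {0..t}"
    by (rule integrable_continuous_real[OF continuous_on_subset[OF assms(1)]]) auto
  from Henstock_Kurzweil_Integration.integral_combine[OF assms(2,3) this] show ?thesis
    by simp
qed

text \<open>The space derivatives of \<open>p\<close> are controlled only for positive times, so
  differentiation under the integral is done on \<open>{s..t}\<close> with \<open>s > 0\<close>. The
  second derivative is an integral of the time derivative of \<open>p\<close> and therefore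
  telescopes.\<close>

lemma heat_solution_time_integral_space_derivatives:
  assumes "heat_solution p"
  shows "\<exists>V. \<forall>x s t. 0 < s \<longrightarrow> s \<le> t \<longrightarrow>
           ((\<lambda>y. integral {0..t} (p y) - integral {0..s} (p y)) has_real_derivative V x s t) (at x) \<and>
           ((\<lambda>y. V y s t) has_real_derivative p x t - p x s) (at x)"
proof -
  obtain px pxx where p: "continuous_on (UNIV \<times> {0<..}) (\<lambda>(x, t). px x t)"
      "continuous_on (UNIV \<times> {0<..}) (\<lambda>(x, t). pxx x t)"
      "\<And>x t. t > 0 \<Longrightarrow> (p x has_real_derivative pxx x t) (at t)"
      "\<And>x t. t > 0 \<Longrightarrow> ((\<lambda>y. p y t) has_real_derivative px x t) (at x)"
      "\<And>x t. t > 0 \<Longrightarrow> ((\<lambda>y. px y t) has_real_derivative pxx x t) (at x)"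
    using assms unfolding heat_solution_def by blast
  have int: "g x integrable_on cbox s t"
    if "continuous_on (UNIV \<times> {0<..}) (\<lambda>(x, t). g x t)" "0 < s"
    for g :: "real \<Rightarrow> real \<Rightarrow> real" and x s t
    by (rule integrable_continuous, rule continuous_on_curried[OF that(1)]) (use that(2) in auto)
  show ?thesis
  proof (intro exI[of _ "\<lambda>x s t. integral {s..t} (px x)"] allI impI conjI)
    fix x s t :: real assume s: "0 < s" "s \<le> t"
    have sub: "UNIV \<times> cbox s t \<subseteq> UNIV \<times> {0<..}"
      using s by auto
    have "((\<lambda>y. integral (cbox s t) (p y)) has_real_derivative integral (cbox s t) (px x)) (at x within UNIV)"
    proof (rule leibniz_rule_field_derivative)
      show "p y integrable_on cbox s t" for y
        by (rule integrable_continuous, rule continuous_on_subset[OF heat_solution_slice[OF assms]])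
          (use s in auto)
      show "((\<lambda>y. p y r) has_real_derivative px y r) (at y within UNIV)" if "r \<in> cbox s t" for y r
        using p(4) s that by simp
      show "continuous_on (UNIV \<times> cbox s t) (\<lambda>(y, r). px y r)"
        by (rule continuous_on_subset[OF p(1) sub])
    qed simp_all
    then show "((\<lambda>y. integral {0..t} (p y) - integral {0..s} (p y)) has_real_derivative
        integral {s..t} (px x)) (at x)"
      using s by (simp add: integral_diff_initial[OF heat_solution_slice[OF assms]])
    have "((\<lambda>y. integral (cbox s t) (px y)) has_real_derivative integral (cbox s t) (pxx x)) (at x within UNIV)"
    proof (rule leibniz_rule_field_derivative)
      show "px y integrable_on cbox s t" for y
        using int[OF p(1) s(1)] .
      show "((\<lambda>y. px y r) has_real_derivative pxx y r) (at y within UNIV)" if "r \<in> cbox s t" for y r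
        using p(5) s that by simp
      show "continuous_on (UNIV \<times> cbox s t) (\<lambda>(y, r). pxx y r)"
        by (rule continuous_on_subset[OF p(2) sub])
    qed simp_all
    moreover have "(pxx x has_integral p x t - p x s) {s..t}"
    proof (rule fundamental_theorem_of_calculus[OF s(2)])
      show "(p x has_vector_derivative pxx x r) (at r within {s..t})" if "r \<in> {s..t}" for r
        using p(3)[of r x] s that
        by (simp add: has_real_derivative_iff_has_vector_derivative[symmetric]
            has_field_derivative_at_within)
    qed
    ultimately show "((\<lambda>y. integral {s..t} (px y)) has_real_derivative p x t - p x s) (at x)"
      by (simp add: integral_unique)
  qed
qed

lemma time_integral_mono:
  fixes f :: "real \<Rightarrow> real"
  assumes "continuous_on {0..} f" "\<And>t. 0 \<le> t \<Longrightarrow> f t \<ge> 0" "0 \<le> s" "s \<le> t"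
  shows "integral {0..s} f \<le> integral {0..t} f"
proof -
  have "f integrable_on {a..b}" if "0 \<le> a" for a b
    by (rule integrable_continuous_real[OF continuous_on_subset[OF assms(1)]]) (use that in auto)
  then show ?thesis
    by (intro integral_subset_le) (use assms in auto)
qed

lemma time_integral_tendsto_0:
  fixes f :: "real \<Rightarrow> real"
  assumes "continuous_on {0..} f"
  shows "((\<lambda>t. integral {0..t} f) \<longlongrightarrow> 0) (at_right 0)"
proof -
  have "continuous_on {0..1} (\<lambda>t. integral {0..t} f)"
    by (rule indefinite_integral_continuous_1[OF
        integrable_continuous_real[OF continuous_on_subset[OF assms]]]) auto
  then have "\<forall>x\<in>{0..1}. ((\<lambda>t. integral {0..t} f) \<longlongrightarrow> integral {0..x} f) (at x within {0..1})"
    unfolding continuous_on_def .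
  from bspec[OF this, of 0] have "((\<lambda>t. integral {0..t} f) \<longlongrightarrow> 0) (at 0 within {0..1})"
    by simp
  then show ?thesis
    by (simp add: at_within_Icc_at_right)
qed

text \<open>
  A positive solution cannot be large far out without making it large at the origin later: the
  time integral is a supersolution that increases in time, and at \<open>x\<^sub>0\<close> it dominates a multiple of
  the caloric function \<open>exp (c (x - x\<^sub>0) + c\<^sup>2 (t - T)) - exp (- c\<^sup>2 (T - s))\<close>, where
  \<open>c = 2 x\<^sub>0 / (T - s)\<close> makes it nonpositive at \<open>t = s\<close> and at \<open>x = - x\<^sub>0\<close>.
\<close>

lemma positive_heat_solution_growth_right:
  assumes p: "heat_solution p" and nonneg: "\<And>x t. 0 \<le> t \<Longrightarrow> p x t \<ge> 0"
    and s: "0 < s" "s < T" and x0: "x0 > 0"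
  shows "integral {0..s} (p x0) * (exp (- (2 * x0\<^sup>2 / (T - s))) - exp (- (4 * x0\<^sup>2 / (T - s))))
           \<le> integral {0..T} (p 0)"
proof -
  define J where "J x t = integral {0..t} (p x)" for x t
  define c where "c = 2 * x0 / (T - s)"
  have c: "c > 0" "c * x0 = 2 * x0\<^sup>2 / (T - s)" "c\<^sup>2 * (T - s) = 4 * x0\<^sup>2 / (T - s)"
    "c\<^sup>2 * (T - s) = 2 * (c * x0)"
  proof -
    define d where "d = T - s"
    have "d > 0"
      using s by (simp add: d_def)
    then show "c > 0" "c * x0 = 2 * x0\<^sup>2 / (T - s)" "c\<^sup>2 * (T - s) = 4 * x0\<^sup>2 / (T - s)"
      unfolding c_def d_def[symmetric] using x0
      by (simp_all add: power2_eq_square)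
    then show "c\<^sup>2 * (T - s) = 2 * (c * x0)"
      by simp
  qed
  define b where "b x t = exp (c * (x - x0) + c\<^sup>2 * (t - T)) - exp (- (c\<^sup>2 * (T - s)))" for x t
  note cont = heat_solution_slice[OF p]
  have J_mono: "J x t \<le> J x t'" if "0 \<le> t" "t \<le> t'" for x t t'
    unfolding J_def using time_integral_mono[OF cont nonneg that] .
  have J_nonneg: "J x t \<ge> 0" if "0 \<le> t" for x t
    using J_mono[of 0 t x] that by (simp add: J_def)
  obtain V where "\<forall>x s t. 0 < s \<longrightarrow> s \<le> t \<longrightarrow>
      ((\<lambda>y. J y t - J y s) has_real_derivative V x s t) (at x) \<and>
      ((\<lambda>y. V y s t) has_real_derivative p x t - p x s) (at x)"
    using heat_solution_time_integral_space_derivatives[OF p, folded J_def] by (elim exE)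
  note V = this[rule_format, THEN conjunct1] this[rule_format, THEN conjunct2]
  have J_cont: "continuous_on ({-x0..x0} \<times> {s..T}) (\<lambda>z. J (fst z) (snd z))"
    using continuous_on_subset[OF continuous_on_time_integral[OF heat_solution_continuous[OF p]],
        of "{-x0..x0} \<times> {s..T}"] s
    unfolding J_def case_prod_unfold by force
  have J_cont': "continuous_on ({-x0..x0} \<times> {s..T}) (\<lambda>z. J (fst z) e)" if "0 \<le> e" for e
    unfolding J_def
    by (rule continuous_on_curried[OF continuous_on_time_integral[OF heat_solution_continuous[OF p]]])
      (use that in \<open>auto intro!: continuous_intros\<close>)
  \<comment> \<open>The cutoff \<open>e > 0\<close> is there because only increments between
    positive times are known to be differentiable in \<open>x\<close>. It does no harm: the function
    below satisfies \<open>Ft - Fxx = p x e \<ge> 0\<close>, as the exponential parts cancel, and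
    \<open>e\<close> tends to 0 at the end.\<close>
  have main: "(J x0 s - J x0 e) * (exp (- (c * x0)) - exp (- (2 * (c * x0)))) \<le> J 0 T"
    if e: "0 < e" "e < s" for e
  proof -
    define M where "M = J x0 s - J x0 e"
    have M: "M \<ge> 0"
      using J_mono[of e s x0] e by (simp add: M_def)
    have "J 0 T - J 0 e - M * b 0 T \<ge> 0"
    proof (rule parabolic_minimum_principle[where ?x1.0 = "- x0" and ?x2.0 = x0 and ?t0.0 = s and T = T
          and F = "\<lambda>x t. J x t - J x e - M * b x t"
          and Ft = "\<lambda>x t. p x t - M * (c\<^sup>2 * exp (c * (x - x0) + c\<^sup>2 * (t - T)))"
          and Fx = "\<lambda>x t. V x e t - M * (c * exp (c * (x - x0) + c\<^sup>2 * (t - T)))"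
          and Fxx = "\<lambda>x t. p x t - p x e - M * (c\<^sup>2 * exp (c * (x - x0) + c\<^sup>2 * (t - T)))"])
      have "continuous_on ({-x0..x0} \<times> {s..T}) (\<lambda>z. b (fst z) (snd z))"
        unfolding b_def by (intro continuous_intros)
      then show "continuous_on ({-x0..x0} \<times> {s..T}) (\<lambda>(x, t). J x t - J x e - M * b x t)"
        unfolding case_prod_unfold
        using e by (intro continuous_on_diff continuous_on_mult_left J_cont J_cont') auto
      fix x t assume t: "s < t"
      have "(J x has_real_derivative p x t) (at t)"
        unfolding J_def using heat_solution_DERIV_time_integral[OF p] s t by simp
      then show "((\<lambda>t. J x t - J x e - M * b x t) has_real_derivative
          p x t - M * (c\<^sup>2 * exp (c * (x - x0) + c\<^sup>2 * (t - T)))) (at t)"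
        unfolding b_def by (auto intro!: derivative_eq_intros)
      have "((\<lambda>x. b x t) has_real_derivative c * exp (c * (x - x0) + c\<^sup>2 * (t - T))) (at x)"
        unfolding b_def by (auto intro!: derivative_eq_intros)
      then show "((\<lambda>x. J x t - J x e - M * b x t) has_real_derivative
          V x e t - M * (c * exp (c * (x - x0) + c\<^sup>2 * (t - T)))) (at x)"
        using e t by (intro DERIV_diff DERIV_cmult V) auto
      have "((\<lambda>x. c * exp (c * (x - x0) + c\<^sup>2 * (t - T))) has_real_derivative
          c\<^sup>2 * exp (c * (x - x0) + c\<^sup>2 * (t - T))) (at x)"
        by (auto intro!: derivative_eq_intros simp: power2_eq_square)
      then show "((\<lambda>x. V x e t - M * (c * exp (c * (x - x0) + c\<^sup>2 * (t - T)))) has_real_derivative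
          p x t - p x e - M * (c\<^sup>2 * exp (c * (x - x0) + c\<^sup>2 * (t - T)))) (at x)"
        using e t by (intro DERIV_diff[of "\<lambda>x. V x e t"] DERIV_cmult V) auto
      show "0 \<le> p x t - M * (c\<^sup>2 * exp (c * (x - x0) + c\<^sup>2 * (t - T))) -
          (p x t - p x e - M * (c\<^sup>2 * exp (c * (x - x0) + c\<^sup>2 * (t - T))))"
        using nonneg e by simp
    next
      fix x assume x: "x \<le> x0"
      have "c * (x - x0) \<le> 0"
        using x c(1) by (simp add: mult_nonneg_nonpos)
      then have "b x s \<le> 0"
        by (simp add: b_def algebra_simps)
      then have "M * b x s \<le> 0"
        using M by (simp add: mult_nonneg_nonpos)
      then show "0 \<le> J x s - J x e - M * b x s"
        using J_mono[of e s x] e by simp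
    next
      fix t assume t: "s \<le> t" "t \<le> T"
      have ct: "c\<^sup>2 * (t - T) \<le> 0"
        using t by (simp add: mult_nonneg_nonpos)
      have "c * (- x0 - x0) = - (c\<^sup>2 * (T - s))"
        using c(4) by (simp add: algebra_simps)
      then have "b (- x0) t \<le> 0"
        using ct by (simp add: b_def)
      then have "M * b (- x0) t \<le> 0"
        using M by (simp add: mult_nonneg_nonpos)
      then show "0 \<le> J (- x0) t - J (- x0) e - M * b (- x0) t"
        using J_mono[of e t "- x0"] e t by simp
      have "exp (c\<^sup>2 * (t - T)) \<le> 1"
        using ct by simp
      moreover have "b x0 t = exp (c\<^sup>2 * (t - T)) - exp (- (c\<^sup>2 * (T - s)))"
        by (simp add: b_def)
      ultimately have "b x0 t \<le> 1"
        using exp_gt_zero[of "- (c\<^sup>2 * (T - s))"] by linarith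
      then have "M * b x0 t \<le> M"
        using M mult_left_le by blast
      then show "0 \<le> J x0 t - J x0 e - M * b x0 t"
        using J_mono[of s t x0] s t by (simp add: M_def)
    qed (use x0 s in auto)
    moreover have "b 0 T = exp (- (c * x0)) - exp (- (2 * (c * x0)))"
      by (simp add: b_def c(4))
    ultimately show ?thesis
      using J_nonneg[of e 0] e by (simp add: M_def)
  qed
  have "((\<lambda>e. (J x0 s - J x0 e) * (exp (- (c * x0)) - exp (- (2 * (c * x0))))) \<longlongrightarrow>
      (J x0 s - 0) * (exp (- (c * x0)) - exp (- (2 * (c * x0))))) (at_right 0)"
    unfolding J_def by (intro tendsto_intros time_integral_tendsto_0 cont)
  moreover have "eventually (\<lambda>e. (J x0 s - J x0 e) * (exp (- (c * x0)) - exp (- (2 * (c * x0)))) \<le> J 0 T) (at_right 0)"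
    using eventually_at_right_less[of "0::real"] eventually_at_right_real[OF s(1)]
    by eventually_elim (auto intro!: main)
  ultimately have "(J x0 s - 0) * (exp (- (c * x0)) - exp (- (2 * (c * x0)))) \<le> J 0 T"
    by (rule tendsto_upperbound) simp
  then show ?thesis
    by (simp add: J_def c(2))
qed

text \<open>The horizon \<open>65 * S\<close> leaves the time span \<open>64 * S\<close>, which
  turns the two exponents of the one-sided bound into \<open>X\<close> and \<open>2 * X\<close> with
  \<open>X = x\<^sup>2 / (32 * S)\<close>. This rate is half of that of the barrier, so the barrier
  wins. The restriction on \<open>x\<close> means \<open>X \<ge> 1\<close>, whence the subtracted
  exponential is at most half of the other.\<close>

lemma positive_heat_solution_growth:
  assumes p: "heat_solution p" and nonneg: "\<And>x t. 0 \<le> t \<Longrightarrow> p x t \<ge> 0" and S: "S > 0"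
  shows "\<exists>K\<ge>0. \<forall>x. x\<^sup>2 \<ge> 32 * S \<longrightarrow> integral {0..S} (p x) \<le> K * exp (x\<^sup>2 / (32 * S))"
proof (intro exI conjI allI impI)
  let ?K = "2 * integral {0..65 * S} (p 0)"
  have "integral {0..0} (p 0) \<le> integral {0..65 * S} (p 0)"
    by (rule time_integral_mono) (use heat_solution_slice[OF p] nonneg S in auto)
  then show "?K \<ge> 0"
    by simp
  fix x :: real assume x: "x\<^sup>2 \<ge> 32 * S"
  define X where "X = x\<^sup>2 / (32 * S)"
  have X: "X \<ge> 1"
    using x S by (simp add: X_def)
  have T: "2 * x\<^sup>2 / (65 * S - S) = X" "4 * x\<^sup>2 / (65 * S - S) = 2 * X"
    using S by (auto simp: X_def field_simps)
  have "x \<noteq> 0"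
    using x S by auto
  then consider "x > 0" | "- x > 0"
    by linarith
  then have "integral {0..S} (p x) * (exp (- X) - exp (- (2 * X))) \<le> integral {0..65 * S} (p 0)"
  proof cases
    case 1
    show ?thesis
      using positive_heat_solution_growth_right[OF p nonneg S, of "65 * S" x] 1 S
      unfolding T by simp
  next
    case 2
    have "heat_solution (\<lambda>x t. p (- x) t)"
      using heat_solution_affine[OF p, of "-1" 0] by simp
    then show ?thesis
      using positive_heat_solution_growth_right[of "\<lambda>x t. p (- x) t" S "65 * S" "- x"] nonneg 2 S
      unfolding power2_minus T by simp
  qed
  moreover have "exp (- X) - exp (- (2 * X)) \<ge> exp (- X) / 2"
  proof -
    have "exp X \<ge> 2"
      using exp_ge_add_one_self[of X] X by linarith
    then have "exp (- X) \<le> 1 / 2"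
      by (simp add: exp_minus field_simps)
    then have "exp (- X) * exp (- X) \<le> exp (- X) * (1 / 2)"
      by (intro mult_left_mono) auto
    then show ?thesis
      by (simp add: exp_add[symmetric])
  qed
  moreover have "integral {0..S} (p x) \<ge> 0"
    by (rule integral_nonneg) (use nonneg in \<open>auto intro!: integrable_continuous_real
        continuous_on_subset[OF heat_solution_slice[OF p]]\<close>)
  ultimately have "integral {0..S} (p x) * (exp (- X) / 2) \<le> integral {0..65 * S} (p 0)"
    by (meson mult_left_mono order_trans)
  then have "integral {0..S} (p x) * (exp (- X) / 2) * (2 * exp X) \<le> integral {0..65 * S} (p 0) * (2 * exp X)"
    by (rule mult_right_mono) simp
  moreover have "integral {0..S} (p x) * (exp (- X) / 2) * (2 * exp X) = integral {0..S} (p x)"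
    by (simp add: exp_minus)
  moreover have "integral {0..65 * S} (p 0) * (2 * exp X) = ?K * exp (x\<^sup>2 / (32 * S))"
    by (simp add: X_def)
  ultimately show "integral {0..S} (p x) \<le> ?K * exp (x\<^sup>2 / (32 * S))"
    by (simp only:)
qed

lemma barrier_tendsto_0:
  fixes T K A :: real
  assumes "T > 0"
  shows "((\<lambda>L. K * exp (L\<^sup>2 / (32 * T)) * exp ((A - L\<^sup>2) / (16 * T))) \<longlongrightarrow> 0) at_top"
proof -
  have "filterlim (\<lambda>L::real. 1 / (32 * T) * L\<^sup>2) at_top at_top"
    using assms by (intro filterlim_tendsto_pos_mult_at_top[OF tendsto_const] filterlim_pow_at_top filterlim_ident) auto
  then have "((\<lambda>L. exp (- (1 / (32 * T) * L\<^sup>2))) \<longlongrightarrow> 0) at_top"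
    by (intro filterlim_compose[OF exp_at_bot]) (simp add: filterlim_uminus_at_bot)
  then have lim: "((\<lambda>L. K * exp (A / (16 * T)) * exp (- (1 / (32 * T) * L\<^sup>2))) \<longlongrightarrow> K * exp (A / (16 * T)) * 0) at_top"
    by (intro tendsto_mult tendsto_const)
  have eq: "K * exp (A / (16 * T)) * exp (- (1 / (32 * T) * L\<^sup>2)) =
      K * exp (L\<^sup>2 / (32 * T)) * exp ((A - L\<^sup>2) / (16 * T))" for L
  proof -
    have "A / (16 * T) + - (1 / (32 * T) * L\<^sup>2) = L\<^sup>2 / (32 * T) + (A - L\<^sup>2) / (16 * T)"
      using assms by (simp add: field_simps)
    then show ?thesis
      by (simp only: mult.assoc exp_add[symmetric])
  qed
  show ?thesis
    using lim unfolding eq mult_zero_right .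
qed

text \<open>
  Widder's uniqueness theorem in comparison form. Positivity controls only time integrals of
  solutions, so the comparison is first made for \<open>\<integral>\<^sub>0\<^sup>t (q - p)\<close> and then for
  \<open>\<integral>\<^sub>t\<^bsup>t+h\<^esup> (q - p)\<close>, which solves the heat equation and has nonnegative initial values by the first step.
\<close>

theorem positive_heat_solution_comparison:
  assumes p: "heat_solution p" and q: "heat_solution q"
    and p_nonneg: "\<And>x t. 0 \<le> t \<Longrightarrow> p x t \<ge> 0" and q_nonneg: "\<And>x t. 0 \<le> t \<Longrightarrow> q x t \<ge> 0"
    and init: "\<And>x. p x 0 \<le> q x 0" and t: "t \<ge> 0"
  shows "p x t \<le> q x t"
proof -
  define d where "d x t = q x t - p x t" for x t
  have d: "heat_solution d"
    unfolding d_def by (rule heat_solution_diff[OF q p])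
  define D where "D x t = integral {0..t} (d x)" for x t
  define J where "J x t = integral {0..t} (p x)" for x t
  note p_cont = heat_solution_slice[OF p] and d_cont = heat_solution_slice[OF d]
  have J_mono: "J x t \<le> J x t'" if "0 \<le> t" "t \<le> t'" for x t t'
    unfolding J_def using time_integral_mono[OF p_cont p_nonneg that] .
  have J_nonneg: "J x t \<ge> 0" if "0 \<le> t" for x t
    using J_mono[of 0 t x] that by (simp add: J_def)
  \<comment> \<open>Dropping the nonnegative integral of \<open>q\<close> leaves only that of
    \<open>p\<close>, so the growth bound for \<open>p\<close> suffices on the sides.\<close>
  have D_ge: "D x t - D x s \<ge> - J x t" if st: "0 \<le> s" "s \<le> t" for x s t
  proof -
    have int: "f integrable_on {s..t}" if "continuous_on {0..} f" for f :: "real \<Rightarrow> real"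
      by (rule integrable_continuous_real[OF continuous_on_subset[OF that]]) (use st in auto)
    have "integral {s..t} (\<lambda>r. - p x r) \<le> integral {s..t} (d x)"
      by (rule integral_le)
        (use int[OF p_cont] int[OF d_cont] q_nonneg st in \<open>auto simp: d_def intro: integrable_neg\<close>)
    moreover have "integral {s..t} (p x) \<le> J x t"
      using integral_diff_initial[OF p_cont st, of x] J_nonneg[of s x] st by (simp add: J_def)
    ultimately show ?thesis
      using integral_diff_initial[OF d_cont st, of x] by (simp add: D_def)
  qed
  have D_cont: "continuous_on (UNIV \<times> {0..}) (\<lambda>(x, t). D x t)"
    unfolding D_def by (rule continuous_on_time_integral[OF heat_solution_continuous[OF d]])
  have D_deriv: "(D x has_real_derivative d x t) (at t)" if "t > 0" for x t
    unfolding D_def by (rule heat_solution_DERIV_time_integral[OF d that])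
  obtain V where "\<forall>x s t. 0 < s \<longrightarrow> s \<le> t \<longrightarrow>
      ((\<lambda>y. D y t - D y s) has_real_derivative V x s t) (at x) \<and>
      ((\<lambda>y. V y s t) has_real_derivative d x t - d x s) (at x)"
    using heat_solution_time_integral_space_derivatives[OF d, folded D_def] by (elim exE)
  note V = this[rule_format, THEN conjunct1] this[rule_format, THEN conjunct2]

  \<comment> \<open>The error \<open>e\<close> is spent in thirds: on the barrier, on the defect
    \<open>\<kappa>\<close> over a time span of at most \<open>T\<close>, and on
    \<open>D x s\<close>. The comparison starts at a time \<open>s > 0\<close> because only
    increments of \<open>D\<close> have space derivatives. They satisfy the heat equation up to the
    source \<open>d y s\<close>, which for small \<open>s\<close> is at least
    \<open>- \<kappa>\<close> by \<open>init\<close> and uniform continuity on the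
    rectangle.\<close>
  have D_nonneg: "D x T \<ge> 0" if T: "T > 0" for x T
  proof (rule field_le_epsilon)
    fix e :: real assume e: "e > 0"
    obtain K where K: "K \<ge> 0" "\<And>x. x\<^sup>2 \<ge> 32 * T \<Longrightarrow> J x T \<le> K * exp (x\<^sup>2 / (32 * T))"
      using positive_heat_solution_growth[OF p p_nonneg T, folded J_def] by blast
    have "eventually (\<lambda>L. K * exp (L\<^sup>2 / (32 * T)) * exp ((x\<^sup>2 * (1 + T / T) + 4 * T - L\<^sup>2) / (16 * T)) < e / 3) at_top"
      by (rule order_tendstoD(2)[OF barrier_tendsto_0[OF T]]) (use e in simp)
    moreover have "filterlim (\<lambda>L::real. L\<^sup>2) at_top at_top"
      by (intro filterlim_pow_at_top filterlim_ident) auto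
    then have "eventually (\<lambda>L::real. 32 * T \<le> L\<^sup>2) at_top"
      by (simp add: filterlim_at_top)
    moreover have "eventually (\<lambda>L. \<bar>x\<bar> \<le> L) at_top"
      by (rule eventually_ge_at_top)
    ultimately have "eventually (\<lambda>L. K * exp (L\<^sup>2 / (32 * T)) * exp ((x\<^sup>2 * (1 + T / T) + 4 * T - L\<^sup>2) / (16 * T)) < e / 3
        \<and> 32 * T \<le> L\<^sup>2 \<and> \<bar>x\<bar> \<le> L) at_top"
      by eventually_elim auto
    from eventually_happens'[OF trivial_limit_at_top_linorder this]
    obtain L where L: "K * exp (L\<^sup>2 / (32 * T)) * exp ((x\<^sup>2 * (1 + T / T) + 4 * T - L\<^sup>2) / (16 * T)) < e / 3"
      "32 * T \<le> L\<^sup>2" "\<bar>x\<bar> \<le> L"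
      by blast
    define \<kappa> where "\<kappa> = e / (3 * T)"
    have \<kappa>: "\<kappa> > 0"
      using e T by (simp add: \<kappa>_def)
    have "uniformly_continuous_on ({-L..L} \<times> {0..T}) (\<lambda>(x, t). d x t)"
      by (intro compact_uniformly_continuous continuous_on_subset[OF heat_solution_continuous[OF d]]
          compact_Times) auto
    then obtain r where r: "r > 0"
      "\<And>z w. z \<in> {-L..L} \<times> {0..T} \<Longrightarrow> w \<in> {-L..L} \<times> {0..T} \<Longrightarrow> dist w z < r \<Longrightarrow>
         dist (case w of (x, t) \<Rightarrow> d x t) (case z of (x, t) \<Rightarrow> d x t) < \<kappa>"
      using \<kappa> unfolding uniformly_continuous_on_def by metis
    have d_ge: "d y s \<ge> - \<kappa>" if "\<bar>y\<bar> \<le> L" "0 < s" "s < r" "s \<le> T" for y s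
      using r(2)[of "(y, 0)" "(y, s)"] that init[of y]
      by (simp add: dist_Pair_Pair dist_real_def d_def abs_le_iff)
    have "eventually (\<lambda>s. \<bar>D x s\<bar> < e / 3) (at_right 0)"
      using tendstoD[OF time_integral_tendsto_0[OF d_cont[of x]], of "e / 3"] e
      by (simp add: dist_real_def D_def)
    moreover have "eventually (\<lambda>s. s < min r T) (at_right 0)" "eventually (\<lambda>s::real. 0 < s) (at_right 0)"
      using eventually_at_right_real[of 0 "min r T"] r(1) T
      by (auto simp: eventually_at_right_less elim: eventually_mono)
    ultimately have "eventually (\<lambda>s. \<bar>D x s\<bar> < e / 3 \<and> s < min r T \<and> 0 < s) (at_right 0)"
      by eventually_elim auto
    from eventually_happens'[OF trivial_limit_at_right_real this]
    obtain s where s: "\<bar>D x s\<bar> < e / 3" "s < r" "s < T" "0 < s"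
      by auto
    have "D x T - D x s \<ge> - \<kappa> * (T - s) -
        (K * exp (L\<^sup>2 / (32 * T))) * exp ((x\<^sup>2 * (1 + T / T) + 4 * T - L\<^sup>2) / (16 * T))"
    proof (rule parabolic_barrier[where F = "\<lambda>x t. D x t - D x s" and Ft = d and Fx = "\<lambda>x t. V x s t"
          and Fxx = "\<lambda>x t. d x t - d x s" and L = L])
      show "continuous_on ({-L..L} \<times> {s..T}) (\<lambda>(x, t). D x t - D x s)"
        unfolding case_prod_unfold
        by (intro continuous_on_diff continuous_on_curried[OF D_cont])
          (use s in \<open>auto intro!: continuous_intros\<close>)
      fix y \<tau> assume y: "\<bar>y\<bar> < L" and \<tau>: "s < \<tau>" "\<tau> \<le> T"
      show "((\<lambda>t. D y t - D y s) has_real_derivative d y \<tau>) (at \<tau>)"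
        using D_deriv[of \<tau> y] \<tau> s by (auto intro!: derivative_eq_intros)
      show "((\<lambda>y. D y \<tau> - D y s) has_real_derivative V y s \<tau>) (at y)"
        "((\<lambda>y. V y s \<tau>) has_real_derivative d y \<tau> - d y s) (at y)"
        using V s \<tau> by simp_all
      show "- \<kappa> \<le> d y \<tau> - (d y \<tau> - d y s)"
        using d_ge[of y s] y s by simp
    next
      fix \<tau> assume \<tau>: "s \<le> \<tau>" "\<tau> \<le> T"
      have "J y \<tau> \<le> K * exp (L\<^sup>2 / (32 * T))" if "y\<^sup>2 = L\<^sup>2" for y
        using J_mono[of \<tau> T y] K(2)[of y] L(2) \<tau> s that by simp
      from this[of L] this[of "- L"]
      show "- (K * exp (L\<^sup>2 / (32 * T))) \<le> D (- L) \<tau> - D (- L) s"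
        "- (K * exp (L\<^sup>2 / (32 * T))) \<le> D L \<tau> - D L s"
        using D_ge[of s \<tau> L] D_ge[of s \<tau> "- L"] \<tau> s by simp_all
    qed (use s T K(1) L(3) \<kappa> in auto)
    moreover have "\<kappa> * (T - s) \<le> e / 3"
    proof -
      have "\<kappa> * (T - s) \<le> \<kappa> * T"
        using \<kappa> s by (intro mult_left_mono) auto
      then show ?thesis
        using T by (simp add: \<kappa>_def)
    qed
    ultimately show "0 \<le> D x T + e"
      using L(1) s(1) by linarith
  qed

  \<comment> \<open>For fixed \<open>h\<close> the increment solves the heat equation exactly at
    every positive time, so the barrier applies with defect 0 and starting time 0, where the value
    is \<open>D y h\<close>.\<close>
  have shift_nonneg: "D x (T + h) - D x T \<ge> 0" if T: "T > 0" and h: "h > 0" for x T h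
  proof (rule field_le_epsilon)
    fix e :: real assume e: "e > 0"
    have Th: "T + h > 0"
      using T h by simp
    obtain K where K: "K \<ge> 0" "\<And>x. x\<^sup>2 \<ge> 32 * (T + h) \<Longrightarrow> J x (T + h) \<le> K * exp (x\<^sup>2 / (32 * (T + h)))"
      using positive_heat_solution_growth[OF p p_nonneg Th, folded J_def] by blast
    have "eventually (\<lambda>L. K * exp (L\<^sup>2 / (32 * T)) * exp ((x\<^sup>2 * (1 + T / T) + 4 * T - L\<^sup>2) / (16 * T)) < e) at_top"
      by (rule order_tendstoD(2)[OF barrier_tendsto_0[OF T]]) (use e in simp)
    moreover have "filterlim (\<lambda>L::real. L\<^sup>2) at_top at_top"
      by (intro filterlim_pow_at_top filterlim_ident) auto
    then have "eventually (\<lambda>L::real. 32 * (T + h) \<le> L\<^sup>2) at_top"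
      by (simp add: filterlim_at_top)
    moreover have "eventually (\<lambda>L. \<bar>x\<bar> \<le> L) at_top"
      by (rule eventually_ge_at_top)
    ultimately have "eventually (\<lambda>L. K * exp (L\<^sup>2 / (32 * T)) * exp ((x\<^sup>2 * (1 + T / T) + 4 * T - L\<^sup>2) / (16 * T)) < e
        \<and> 32 * (T + h) \<le> L\<^sup>2 \<and> \<bar>x\<bar> \<le> L) at_top"
      by eventually_elim auto
    from eventually_happens'[OF trivial_limit_at_top_linorder this]
    obtain L where L: "K * exp (L\<^sup>2 / (32 * T)) * exp ((x\<^sup>2 * (1 + T / T) + 4 * T - L\<^sup>2) / (16 * T)) < e"
      "32 * (T + h) \<le> L\<^sup>2" "\<bar>x\<bar> \<le> L"
      by blast
    have "D x (T + h) - D x T \<ge> - 0 * (T - 0) -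
        (K * exp (L\<^sup>2 / (32 * T))) * exp ((x\<^sup>2 * (1 + T / T) + 4 * T - L\<^sup>2) / (16 * T))"
    proof (rule parabolic_barrier[where F = "\<lambda>x t. D x (t + h) - D x t" and Ft = "\<lambda>x t. d x (t + h) - d x t"
          and Fx = "\<lambda>x t. V x t (t + h)" and Fxx = "\<lambda>x t. d x (t + h) - d x t" and L = L])
      show "continuous_on ({-L..L} \<times> {0..T}) (\<lambda>(x, t). D x (t + h) - D x t)"
        unfolding case_prod_unfold
        by (intro continuous_on_diff continuous_on_curried[OF D_cont])
          (use h in \<open>auto intro!: continuous_intros\<close>)
      fix y \<tau> :: real assume y: "\<bar>y\<bar> < L" and \<tau>: "0 < \<tau>" "\<tau> \<le> T"
      have "((\<lambda>t. D y (t + h)) has_real_derivative d y (\<tau> + h)) (at \<tau>)"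
        using D_deriv[of "\<tau> + h" y] \<tau> h by (simp add: DERIV_shift)
      then show "((\<lambda>t. D y (t + h) - D y t) has_real_derivative d y (\<tau> + h) - d y \<tau>) (at \<tau>)"
        by (intro DERIV_diff D_deriv \<tau>)
      show "((\<lambda>y. D y (\<tau> + h) - D y \<tau>) has_real_derivative V y \<tau> (\<tau> + h)) (at y)"
        "((\<lambda>y. V y \<tau> (\<tau> + h)) has_real_derivative d y (\<tau> + h) - d y \<tau>) (at y)"
        using V h \<tau> by simp_all
    next
      fix y
      show "0 \<le> D y (0 + h) - D y 0"
        using D_nonneg[OF h, of y] by (simp add: D_def)
    next
      fix \<tau> :: real assume \<tau>: "0 \<le> \<tau>" "\<tau> \<le> T"
      \<comment> \<open>Growth is measured over the longer interval up to \<open>T + h\<close>,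
        which only lowers the Gaussian rate; the barrier built for \<open>T\<close> still beats
        it.\<close>
      have "exp (L\<^sup>2 / (32 * (T + h))) \<le> exp (L\<^sup>2 / (32 * T))"
        using T h by (simp add: frac_le)
      then have "K * exp (L\<^sup>2 / (32 * (T + h))) \<le> K * exp (L\<^sup>2 / (32 * T))"
        using K(1) by (rule mult_left_mono)
      then have "J y (\<tau> + h) \<le> K * exp (L\<^sup>2 / (32 * T))" if "y\<^sup>2 = L\<^sup>2" for y
        using J_mono[of "\<tau> + h" "T + h" y] K(2)[of y] L(2) \<tau> h that by simp
      from this[of L] this[of "- L"]
      show "- (K * exp (L\<^sup>2 / (32 * T))) \<le> D (- L) (\<tau> + h) - D (- L) \<tau>"
        "- (K * exp (L\<^sup>2 / (32 * T))) \<le> D L (\<tau> + h) - D L \<tau>"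
        using D_ge[of \<tau> "\<tau> + h" L] D_ge[of \<tau> "\<tau> + h" "- L"] \<tau> h by simp_all
    qed (use T K(1) L(3) in auto)
    then show "0 \<le> D x (T + h) - D x T + e"
      using L(1) by linarith
  qed

  have "d x t \<ge> 0"
  proof (cases "t = 0")
    case True
    then show ?thesis
      using init by (simp add: d_def)
  next
    case False
    then have t: "t > 0"
      using t by simp
    show ?thesis
    proof (rule ccontr)
      assume "\<not> d x t \<ge> 0"
      then obtain r where r: "r > 0" "\<And>h. 0 < h \<Longrightarrow> h < r \<Longrightarrow> D x t > D x (t + h)"
        using DERIV_neg_dec_right[OF D_deriv[OF t, of x]] by auto
      show False
        using r(2)[of "r / 2"] r(1) shift_nonneg[OF t, of "r / 2" x] by simp
    qed
  qed
  then show ?thesis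
    by (simp add: d_def)
qed

section \<open>The Cole--Hopf transform\<close>

lemma integral_FTC_unit:
  fixes F f :: "real \<Rightarrow> real"
  assumes "\<And>r. 0 \<le> r \<Longrightarrow> r \<le> 1 \<Longrightarrow> (F has_real_derivative f r) (at r)"
  shows "integral {0..1} f = F 1 - F 0"
proof (rule integral_unique, rule fundamental_theorem_of_calculus)
  show "(F has_vector_derivative f r) (at r within {0..1})" if "r \<in> {0..1}" for r
    using assms[of r] that
    by (simp add: has_real_derivative_iff_has_vector_derivative[symmetric] has_field_derivative_at_within)
qed simp

lemma DERIV_integral_unit:
  fixes f fx :: "real \<Rightarrow> real \<Rightarrow> real"
  assumes U: "open U" "convex U" "x \<in> U"
    and deriv: "\<And>y r. y \<in> U \<Longrightarrow> ((\<lambda>y. f y r) has_real_derivative fx y r) (at y)"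
    and cont: "\<And>y. y \<in> U \<Longrightarrow> continuous_on {0..1} (f y)"
    and cont': "continuous_on (U \<times> {0..1}) (\<lambda>(y, r). fx y r)"
  shows "((\<lambda>y. integral {0..1} (f y)) has_real_derivative integral {0..1} (fx x)) (at x)"
proof -
  have "((\<lambda>y. integral (cbox 0 1) (f y)) has_real_derivative integral (cbox 0 1) (fx x)) (at x within U)"
  proof (rule leibniz_rule_field_derivative)
    show "((\<lambda>y. f y r) has_real_derivative fx y r) (at y within U)" if "y \<in> U" for y r
      using deriv[OF that] by (rule has_field_derivative_at_within)
    show "f y integrable_on cbox 0 1" if "y \<in> U" for y
      using integrable_continuous_real[OF cont[OF that]] by simp
    show "continuous_on (U \<times> cbox 0 1) (\<lambda>(y, r). fx y r)"
      using cont' by simp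
  qed (use U in auto)
  then show ?thesis
    using at_within_open[OF U(3,1)] by simp
qed

text \<open>
  The Cole--Hopf transform \<open>\<phi> = exp (\<gamma> t - \<integral>\<^sub>0\<^sup>x u)\<close> needs \<open>\<gamma>' = u\<^sup>2 - u\<^sub>x\<close> at \<open>x = 0\<close>, where \<open>u\<^sub>x\<close> need not be
  integrable up to \<open>t = 0\<close>. Averaging the equation for \<open>\<integral>\<^sub>0\<^sup>x u\<close> over \<open>x \<in> [0, 1]\<close> removes \<open>u\<^sub>x\<close>.
\<close>

theorem cole_hopf:
  assumes "burgers_ivp_solution f u"
  shows "\<exists>\<phi> c. heat_solution \<phi> \<and> (\<forall>x t. \<phi> x t > 0) \<and>
    (\<forall>x. \<forall>t>0. ((\<lambda>y. \<phi> y t) has_real_derivative - u x t * \<phi> x t) (at x)) \<and>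
    (\<forall>x. \<phi> x 0 = c * exp (- (x * integral {0..1} (\<lambda>r. f (r * x)))))"
proof -
  obtain ut ux uxx where C: "continuous_on (UNIV \<times> {0<..}) (\<lambda>(x, t). ut x t)"
      "continuous_on (UNIV \<times> {0<..}) (\<lambda>(x, t). ux x t)"
      "continuous_on (UNIV \<times> {0<..}) (\<lambda>(x, t). uxx x t)"
    and D: "\<And>x t. t > 0 \<Longrightarrow> ((\<lambda>s. u x s) has_real_derivative ut x t) (at t)"
      "\<And>x t. t > 0 \<Longrightarrow> ((\<lambda>y. u y t) has_real_derivative ux x t) (at x)"
      "\<And>x t. t > 0 \<Longrightarrow> ((\<lambda>y. ux y t) has_real_derivative uxx x t) (at x)"
    and burgers: "\<And>x t. t > 0 \<Longrightarrow> ut x t + 2 * u x t * ux x t = uxx x t"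
    using assms unfolding burgers_ivp_solution_def by blast
  have C0: "continuous_on (UNIV \<times> {0..}) (\<lambda>(x, t). u x t)" and init: "\<And>x. u x 0 = f x"
    using assms unfolding burgers_ivp_solution_def by blast+
  note U = continuous_on_curried[OF C0] and Ux = continuous_on_curried[OF C(2)]
    and Ut = continuous_on_curried[OF C(1)]

  \<comment> \<open>This is the integral of \<open>u\<close> from 0 to \<open>x\<close>, written
    over the unit interval so that negative \<open>x\<close> needs no separate treatment.\<close>
  define P where "P x t = integral {0..1} (\<lambda>r. x * u (r * x) t)" for x t
  have P_cont: "continuous_on (UNIV \<times> {0..}) (\<lambda>z. P (fst z) (snd z))"
    unfolding P_def cbox_interval[symmetric]
    by (rule integral_continuous_on_param, unfold case_prod_unfold)
      (intro continuous_intros U; auto)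
  have P_x: "((\<lambda>x. P x t) has_real_derivative u x t) (at x)" if t: "t > 0" for x t
  proof -
    have "((\<lambda>x. P x t) has_real_derivative
        integral {0..1} (\<lambda>r. u (r * x) t + x * (ux (r * x) t * r))) (at x)"
      unfolding P_def
    proof (rule DERIV_integral_unit[of UNIV])
      show "((\<lambda>x. x * u (r * x) t) has_real_derivative u (r * x) t + x * (ux (r * x) t * r)) (at x)" for x r
      proof -
        have "((\<lambda>x. r * x) has_real_derivative r) (at x)"
          by (auto intro!: derivative_eq_intros)
        from DERIV_mult[OF DERIV_ident DERIV_chain2[of "\<lambda>y. u y t", OF D(2)[OF t] this]]
        show ?thesis by (simp add: mult_ac)
      qed
      show "continuous_on {0..1} (\<lambda>r. x * u (r * x) t)" for x
        by (intro continuous_intros U) (use t in auto)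
      show "continuous_on (UNIV \<times> {0..1}) (\<lambda>(x, r). u (r * x) t + x * (ux (r * x) t * r))"
        unfolding case_prod_unfold by (intro continuous_intros U Ux) (use t in auto)
    qed auto
    moreover have "integral {0..1} (\<lambda>r. u (r * x) t + x * (ux (r * x) t * r)) = 1 * u (1 * x) t - 0 * u (0 * x) t"
    proof (rule integral_FTC_unit)
      fix r :: real
      have "((\<lambda>r. r * x) has_real_derivative x) (at r)"
        by (auto intro!: derivative_eq_intros)
      from DERIV_mult[OF DERIV_ident DERIV_chain2[of "\<lambda>y. u y t", OF D(2)[OF t] this]]
      show "((\<lambda>r. r * u (r * x) t) has_real_derivative u (r * x) t + x * (ux (r * x) t * r)) (at r)"
        by (simp add: mult_ac)
    qed
    ultimately show ?thesis
      by simp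
  qed
  \<comment> \<open>The equation is the conservation law with flux \<open>ux - u\<^sup>2\<close>, so
    the time derivative of \<open>P\<close> is the difference of the flux at \<open>x\<close> and at
    0; \<open>c\<close> is the flux at 0.\<close>
  define c where "c t = ux 0 t - (u 0 t)\<^sup>2" for t
  have P_t: "(P x has_real_derivative ux x t - (u x t)\<^sup>2 - c t) (at t)" if t: "t > 0" for x t
  proof -
    have "(P x has_real_derivative integral {0..1} (\<lambda>r. x * ut (r * x) t)) (at t)"
      unfolding P_def
    proof (rule DERIV_integral_unit[of "{0<..}"])
      show "((\<lambda>t. x * u (r * x) t) has_real_derivative x * ut (r * x) t) (at t)" if "t \<in> {0<..}" for r t
        using that by (intro DERIV_cmult D) auto
      show "continuous_on {0..1} (\<lambda>r. x * u (r * x) t)" if "t \<in> {0<..}" for t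
        by (intro continuous_intros U) (use that in auto)
      show "continuous_on ({0<..} \<times> {0..1}) (\<lambda>(t, r). x * ut (r * x) t)"
        unfolding case_prod_unfold by (intro continuous_intros Ut) auto
    qed (use t in auto)
    moreover have "integral {0..1} (\<lambda>r. x * ut (r * x) t) =
        (ux (1 * x) t - (u (1 * x) t)\<^sup>2) - (ux (0 * x) t - (u (0 * x) t)\<^sup>2)"
    proof (rule integral_FTC_unit)
      fix r :: real
      have lin: "((\<lambda>r. r * x) has_real_derivative x) (at r)"
        by (auto intro!: derivative_eq_intros)
      note dux = DERIV_chain2[of "\<lambda>y. ux y t", OF D(3)[OF t] lin]
        and du = DERIV_chain2[of "\<lambda>y. u y t", OF D(2)[OF t] lin]
      have "((\<lambda>r. ux (r * x) t - (u (r * x) t)\<^sup>2) has_real_derivative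
          uxx (r * x) t * x - 2 * u (r * x) t * (ux (r * x) t * x)) (at r)"
        using DERIV_diff[OF dux DERIV_power[OF du, of 2]] by (simp add: mult_ac)
      moreover have "uxx (r * x) t * x - 2 * u (r * x) t * (ux (r * x) t * x) = x * ut (r * x) t"
        using burgers[OF t, of "r * x"] by (simp add: algebra_simps flip: burgers[OF t, of "r * x"])
      ultimately show "((\<lambda>r. ux (r * x) t - (u (r * x) t)\<^sup>2) has_real_derivative x * ut (r * x) t) (at r)"
        by simp
    qed
    ultimately show ?thesis
      by (simp add: c_def)
  qed

  \<comment> \<open>Averaging the time derivative of \<open>P\<close> over the unit interval gives
    \<open>Q' = - c - \<rho>\<close>, because \<open>ux\<close> integrates to boundary values of
    \<open>u\<close>. Thus \<open>\<rho>\<close> is continuous up to \<open>t = 0\<close>, and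
    \<open>\<gamma>\<close> gets the derivative \<open>- c\<close> although \<open>c\<close> itself
    is never integrated.\<close>
  define Q where "Q t = integral {0..1} (\<lambda>x. P x t)" for t
  define \<rho> where "\<rho> t = u 0 t - u 1 t + integral {0..1} (\<lambda>x. (u x t)\<^sup>2)" for t
  define \<gamma> where "\<gamma> t = Q t + integral {0..t} \<rho>" for t
  have \<rho>_cont: "continuous_on {0..} \<rho>"
  proof -
    have "continuous_on {0..} (\<lambda>t. integral (cbox 0 1) (\<lambda>x. (u x t)\<^sup>2))"
      by (rule integral_continuous_on_param, unfold case_prod_unfold) (intro continuous_intros U; auto)
    then show ?thesis
      unfolding \<rho>_def by (intro continuous_intros U) auto
  qed
  have Q_cont: "continuous_on {0..} Q"
  proof -
    have "continuous_on ({0..} \<times> cbox 0 1) (\<lambda>(t, x). P x t)"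
      unfolding case_prod_unfold
      by (rule continuous_on_curried[where X = UNIV and Y = "{0..}" and f = P])
        (use P_cont in \<open>auto simp: case_prod_unfold intro!: continuous_intros\<close>)
    then have "continuous_on {0..} (\<lambda>t. integral (cbox 0 1) (\<lambda>x. P x t))"
      by (rule integral_continuous_on_param)
    then show ?thesis
      by (simp add: Q_def[abs_def])
  qed
  have \<gamma>_cont: "continuous_on {0..} \<gamma>"
  proof -
    have "continuous_on (UNIV \<times> {0..}) (\<lambda>(x :: real, t). \<rho> t)"
      unfolding case_prod_unfold
      by (rule continuous_on_compose2[OF \<rho>_cont]) (auto intro!: continuous_intros)
    from continuous_on_curried[OF continuous_on_time_integral[OF this], of "{0..}" "\<lambda>_. 0" "\<lambda>t. t"]
    show ?thesis
      unfolding \<gamma>_def by (intro continuous_intros Q_cont) auto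
  qed
  have \<gamma>_t: "(\<gamma> has_real_derivative - c t) (at t)" if t: "t > 0" for t
  proof -
    have "(Q has_real_derivative integral {0..1} (\<lambda>x. ux x t - (u x t)\<^sup>2 - c t)) (at t)"
      unfolding Q_def
    proof (rule DERIV_integral_unit[of "{0<..}"])
      show "((\<lambda>t. P x t) has_real_derivative ux x t - (u x t)\<^sup>2 - c t) (at t)" if "t \<in> {0<..}" for x t
        using P_t that by simp
      show "continuous_on {0..1} (\<lambda>x. P x t)" if "t \<in> {0<..}" for t
        by (rule continuous_on_curried[where X = UNIV and Y = "{0..}" and f = P])
          (use P_cont that in \<open>auto simp: case_prod_unfold intro!: continuous_intros\<close>)
      show "continuous_on ({0<..} \<times> {0..1}) (\<lambda>(t, x). ux x t - (u x t)\<^sup>2 - c t)"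
        unfolding case_prod_unfold c_def by (intro continuous_intros U Ux) auto
    qed (use t in auto)
    moreover have "integral {0..1} (\<lambda>x. ux x t - (u x t)\<^sup>2 - c t) = - c t - \<rho> t"
    proof -
      have i1: "(\<lambda>x. ux x t) integrable_on {0..1}"
        by (intro integrable_continuous_real Ux continuous_intros) (use t in auto)
      have i2: "(\<lambda>x. (u x t)\<^sup>2) integrable_on {0..1}"
        by (intro integrable_continuous_real continuous_intros U) (use t in auto)
      have "integral {0..1} (\<lambda>x. ux x t - (u x t)\<^sup>2 - c t) =
          integral {0..1} (\<lambda>x. ux x t) - integral {0..1} (\<lambda>x. (u x t)\<^sup>2) - integral {0..1} (\<lambda>x::real. c t)"
        by (simp only: Henstock_Kurzweil_Integration.integral_diff i1 i2 integrable_diff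
            integrable_const_ivl)
      also have "integral {0..1} (\<lambda>x. ux x t) = u 1 t - u 0 t"
        by (rule integral_FTC_unit) (rule D(2)[OF t])
      finally show ?thesis
        by (simp add: \<rho>_def)
    qed
    ultimately have "(Q has_real_derivative - c t - \<rho> t) (at t)"
      by simp
    from DERIV_add[OF this DERIV_integral_upper[OF \<rho>_cont t]] show ?thesis
      by (simp add: \<gamma>_def[abs_def])
  qed

  define \<phi> where "\<phi> x t = exp (\<gamma> t - P x t)" for x t
  have \<phi>_x: "((\<lambda>y. \<phi> y t) has_real_derivative - u x t * \<phi> x t) (at x)" if t: "t > 0" for x t
    unfolding \<phi>_def using P_x[OF t, of x] by (auto intro!: derivative_eq_intros)
  have "heat_solution \<phi>"
  proof (rule heat_solutionI[where p\<^sub>x = "\<lambda>x t. - u x t * \<phi> x t"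
        and p\<^sub>x\<^sub>x = "\<lambda>x t. ((u x t)\<^sup>2 - ux x t) * \<phi> x t"])
    have "continuous_on (UNIV \<times> {0..}) (\<lambda>z. \<gamma> (snd z))"
      by (rule continuous_on_compose2[OF \<gamma>_cont]) (auto intro!: continuous_intros)
    then show \<phi>_cont: "continuous_on (UNIV \<times> {0..}) (\<lambda>(x, t). \<phi> x t)"
      unfolding \<phi>_def case_prod_unfold by (intro continuous_intros P_cont)
    note Phi = continuous_on_curried[OF \<phi>_cont]
    show "continuous_on (UNIV \<times> {0<..}) (\<lambda>(x, t). - u x t * \<phi> x t)"
      unfolding case_prod_unfold by (intro continuous_intros U Phi) auto
    show "continuous_on (UNIV \<times> {0<..}) (\<lambda>(x, t). ((u x t)\<^sup>2 - ux x t) * \<phi> x t)"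
      unfolding case_prod_unfold by (intro continuous_intros U Ux Phi) auto
    fix x t :: real assume t: "t > 0"
    show "(\<phi> x has_real_derivative ((u x t)\<^sup>2 - ux x t) * \<phi> x t) (at t)"
      unfolding \<phi>_def using \<gamma>_t[OF t] P_t[OF t, of x] by (auto intro!: derivative_eq_intros)
    show "((\<lambda>y. \<phi> y t) has_real_derivative - u x t * \<phi> x t) (at x)"
      by (rule \<phi>_x[OF t])
    from DERIV_mult[OF DERIV_minus[OF D(2)[OF t]] this]
    show "((\<lambda>y. - u y t * \<phi> y t) has_real_derivative ((u x t)\<^sup>2 - ux x t) * \<phi> x t) (at x)"
      by (simp add: algebra_simps power2_eq_square)
  qed
  moreover have "\<phi> x 0 = exp (\<gamma> 0) * exp (- (x * integral {0..1} (\<lambda>r. f (r * x))))" for x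
    by (simp add: \<phi>_def P_def init exp_diff exp_minus field_simps)
  moreover have "\<phi> x t > 0" for x t
    by (simp add: \<phi>_def)
  ultimately show ?thesis
    using \<phi>_x by blast
qed

section \<open>Exponential majorants\<close>

text \<open>The reflection \<open>i \<mapsto> n - i\<close> maps the upper half injectively into the
  lower half. The strict \<open>n < 2 * i\<close> leaves a middle index in the lower half.\<close>

lemma sum_upto_le_twice_half:
  fixes g :: "nat \<Rightarrow> real"
  assumes "\<And>i. i \<le> n \<Longrightarrow> n < 2 * i \<Longrightarrow> g i \<le> g (n - i)" and "\<And>i. g i \<ge> 0"
  shows "(\<Sum>i\<le>n. g i) \<le> 2 * (\<Sum>i\<le>n div 2. g i)"
proof -
  let ?H = "{i. i \<le> n \<and> n < 2 * i}"
  have split: "{..n} = {..n div 2} \<union> ?H" "{..n div 2} \<inter> ?H = {}"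
    by auto
  have fin: "finite ?H"
    by simp
  have "(\<Sum>i\<in>?H. g i) \<le> (\<Sum>i\<in>?H. g (n - i))"
    using assms(1) by (intro sum_mono) auto
  also have "\<dots> = sum g ((\<lambda>i. n - i) ` ?H)"
    by (rule sum.reindex_cong[symmetric, of "\<lambda>i. n - i"]) (auto intro!: inj_onI)
  also have "\<dots> \<le> (\<Sum>i\<le>n div 2. g i)"
    by (rule sum_mono2) (use assms(2) in auto)
  finally have "(\<Sum>i\<in>?H. g i) \<le> (\<Sum>i\<le>n div 2. g i)" .
  then show ?thesis
    using sum.union_disjoint[OF _ fin split(2), of g] split(1) by simp
qed

lemma power_one_plus_le_lower_half:
  fixes q :: real
  assumes "0 < q" "q \<le> 1"
  shows "(1 + q) ^ n \<le> 2 * (\<Sum>i\<le>n div 2. real (n choose i) * q ^ i)"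
proof -
  have "(1 + q) ^ n = (\<Sum>i\<le>n. real (n choose i) * q ^ i)"
    using binomial_ring[of q 1 n] by (simp add: add.commute)
  also have "\<dots> \<le> 2 * (\<Sum>i\<le>n div 2. real (n choose i) * q ^ i)"
  proof (rule sum_upto_le_twice_half)
    fix i assume i: "i \<le> n" "n < 2 * i"
    have "q ^ i \<le> q ^ (n - i)"
      by (rule power_decreasing) (use assms i in auto)
    then show "real (n choose i) * q ^ i \<le> real (n choose (n - i)) * q ^ (n - i)"
      using i by (simp add: binomial_symmetric[of i n] mult_left_mono)
  qed (use assms in auto)
  finally show ?thesis .
qed

lemma powr_one_plus_minus_one_le:
  fixes q a :: real
  assumes "q > 0" "a \<ge> 1"
  shows "(1 + q) powr a - 1 \<le> a * q * (1 + q) powr (a - 1)"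
proof -
  have "\<exists>z>1. z < 1 + q \<and> (1 + q) powr a - 1 powr a = (1 + q - 1) * (a * z powr (a - 1))"
    by (rule MVT2) (use assms in \<open>auto intro!: derivative_eq_intros\<close>)
  then obtain z where z: "1 < z" "z < 1 + q" "(1 + q) powr a - 1 = q * (a * z powr (a - 1))"
    by auto
  have "z powr (a - 1) \<le> (1 + q) powr (a - 1)"
    using z assms by (intro powr_mono2) auto
  then have "a * q * z powr (a - 1) \<le> a * q * (1 + q) powr (a - 1)"
    using assms by (intro mult_left_mono) auto
  then show ?thesis
    using z(3) by (simp add: mult_ac)
qed

lemma two_cosh_eq: "2 * cosh y = exp y + exp (- y)" for y :: real
  by (simp add: cosh_def)

lemma two_cosh_powr_eq:
  fixes y :: real
  shows "(2 * cosh y) powr b = exp (b * \<bar>y\<bar>) * (1 + exp (- 2 * \<bar>y\<bar>)) powr b"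
proof -
  have "2 * cosh y = exp \<bar>y\<bar> * (1 + exp (- 2 * \<bar>y\<bar>))"
    by (cases "y \<ge> 0") (simp_all add: two_cosh_eq distrib_left exp_add[symmetric])
  then show ?thesis
    by (simp add: powr_mult exp_powr_real mult.commute)
qed

text \<open>With \<open>q = exp (- 2 * \<bar>y\<bar>)\<close> this is
  \<open>exp (a * \<bar>y\<bar>)\<close> times the mean value bound
  \<open>a * q * (1 + q) powr (a - 1)\<close> for \<open>(1 + q) powr a - 1\<close>, that is, a
  bound for what \<open>(2 * cosh y) powr a\<close> exceeds its leading exponential by.\<close>

definition remainder_bound :: "real \<Rightarrow> real \<Rightarrow> real" where
  "remainder_bound a y = a * exp (- \<bar>y\<bar>) * (2 * cosh y) powr (a - 1)"

lemma remainder_bound_eq: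
  "remainder_bound a y = exp (a * \<bar>y\<bar>) * (a * exp (- 2 * \<bar>y\<bar>) * (1 + exp (- 2 * \<bar>y\<bar>)) powr (a - 1))"
proof -
  have "exp (- \<bar>y\<bar>) * exp ((a - 1) * \<bar>y\<bar>) = exp (a * \<bar>y\<bar>) * exp (- 2 * \<bar>y\<bar>)"
    by (simp add: exp_add[symmetric] algebra_simps)
  then show ?thesis
    unfolding remainder_bound_def two_cosh_powr_eq by (simp add: mult_ac)
qed

text \<open>The numbers \<open>exp y / s\<close> and \<open>exp (- y) / s\<close> lie between 0 and
  1 and add up to 1; raising them to a power \<open>a \<ge> 1\<close> can only decrease
  them.\<close>

lemma two_cosh_powr_ge:
  fixes a y :: real
  assumes "a \<ge> 1"
  shows "exp (a * y) + exp (- a * y) \<le> (2 * cosh y) powr a"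
proof -
  define s where "s = 2 * cosh y"
  have s: "s > 0"
    by (simp add: s_def cosh_real_pos)
  have le: "exp (a * z) \<le> s powr a * (exp z / s)" if "exp z \<le> s" for z
  proof -
    have "(exp z / s) powr a \<le> (exp z / s) powr 1"
      by (rule powr_mono') (use assms s that in auto)
    then have "exp (a * z) / s powr a \<le> exp z / s"
      using s by (simp add: powr_divide exp_powr_real mult.commute)
    then show ?thesis
      using s by (simp add: field_simps)
  qed
  have "exp (a * y) + exp (a * - y) \<le> s powr a * (exp y / s) + s powr a * (exp (- y) / s)"
    by (intro add_mono le) (simp_all add: s_def two_cosh_eq)
  also have "\<dots> = s powr a * ((exp y + exp (- y)) / s)"
    by (simp add: distrib_left add_divide_distrib)
  also have "(exp y + exp (- y)) / s = 1"
    using s by (simp add: s_def two_cosh_eq)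
  finally show ?thesis
    by (simp add: s_def)
qed

lemma exp_plus_exp_minus_abs: "exp (a * y) + exp (- a * y) = exp (a * \<bar>y\<bar>) + exp (- a * \<bar>y\<bar>)"
  for a y :: real
  by (cases "y \<ge> 0") simp_all

lemma two_cosh_powr_le:
  fixes a y :: real
  assumes "a \<ge> 1"
  shows "(2 * cosh y) powr a \<le> exp (a * y) + exp (- a * y) + remainder_bound a y"
proof -
  define q where "q = exp (- 2 * \<bar>y\<bar>)"
  have "exp (a * \<bar>y\<bar>) * ((1 + q) powr a - 1) \<le> exp (a * \<bar>y\<bar>) * (a * q * (1 + q) powr (a - 1))"
    by (intro mult_left_mono powr_one_plus_minus_one_le) (use assms in \<open>auto simp: q_def\<close>)
  then have "(2 * cosh y) powr a \<le> exp (a * \<bar>y\<bar>) + remainder_bound a y"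
    unfolding two_cosh_powr_eq remainder_bound_eq q_def by (simp add: algebra_simps)
  also have "\<dots> \<le> exp (a * y) + exp (- a * y) + remainder_bound a y"
    using exp_plus_exp_minus_abs[of a y] exp_ge_zero[of "- a * \<bar>y\<bar>"] by linarith
  finally show ?thesis .
qed

definition remainder_deriv :: "real \<Rightarrow> real \<Rightarrow> real" where
  "remainder_deriv a y =
     a * (2 * cosh y) powr (a - 1) * (2 * sinh y) - (a * exp (a * y) - a * exp (- a * y))"

lemma DERIV_remainder:
  "((\<lambda>y. (2 * cosh y) powr a - (exp (a * y) + exp (- a * y))) has_real_derivative remainder_deriv a y) (at y)"
  unfolding remainder_deriv_def
  by (rule derivative_eq_intros refl | simp add: cosh_real_pos)+

lemma remainder_deriv_minus: "remainder_deriv a (- y) = - remainder_deriv a y"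
  by (simp add: remainder_deriv_def)

text \<open>Differentiating costs only a factor \<open>a\<close>. By oddness
  \<open>y \<ge> 0\<close> suffices; there the derivative is \<open>a * exp (a * y) * g\<close>, and
  \<open>g\<close> is the nonnegative \<open>(1 + q) powr (a - 1) - 1\<close> minus
  \<open>q * (1 + q) powr (a - 1)\<close> plus \<open>q powr a\<close>. The last term never exceeds
  the one before it, so each sign of \<open>g\<close> is governed by a single term of size at most
  \<open>a * q * (1 + q) powr (a - 1)\<close>.\<close>

lemma remainder_deriv_bound:
  assumes "a \<ge> 1"
  shows "\<bar>remainder_deriv a y\<bar> \<le> a * remainder_bound a y"
proof -
  have nonneg: "\<bar>remainder_deriv a z\<bar> \<le> a * remainder_bound a z" if z: "z \<ge> 0" for z
  proof -
    define q where "q = exp (- 2 * z)"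
    have q: "0 < q" "q \<le> 1"
      using z by (auto simp: q_def)
    define g where "g = (1 + q) powr (a - 1) * (1 - q) - 1 + q powr a"
    have "exp ((a - 1) * z) * (exp z - exp (- z)) = exp (a * z) * (1 - q)"
      by (simp add: q_def right_diff_distrib exp_add[symmetric] algebra_simps)
    moreover have "(2 * cosh z) powr (a - 1) * (2 * sinh z) =
        exp ((a - 1) * z) * (exp z - exp (- z)) * (1 + q) powr (a - 1)"
    proof -
      have sinh: "2 * sinh z = exp z - exp (- z)"
        by (simp add: sinh_def)
      show ?thesis
        unfolding sinh two_cosh_powr_eq abs_of_nonneg[OF z] q_def by (simp only: mult_ac)
    qed
    ultimately have e1: "(2 * cosh z) powr (a - 1) * (2 * sinh z) = exp (a * z) * ((1 + q) powr (a - 1) * (1 - q))"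
      by (simp only: mult_ac)
    have e2: "exp (- a * z) = exp (a * z) * q powr a"
      by (simp add: q_def exp_powr_real exp_add[symmetric])
    have eq: "remainder_deriv a z = a * (exp (a * z) * g)"
      unfolding remainder_deriv_def mult.assoc[of a "(2 * cosh z) powr (a - 1)"] e1 e2
      by (simp add: g_def algebra_simps)
    have "(1 + q) powr (a - 1) \<le> (1 + q) powr a"
      using q by (intro powr_mono) auto
    then have 1: "(1 + q) powr (a - 1) - 1 \<le> a * q * (1 + q) powr (a - 1)"
      using powr_one_plus_minus_one_le[OF q(1) assms] by linarith
    have one: "(1 + q) powr (a - 1) \<ge> 1"
      using q assms by (intro ge_one_powr_ge_zero) auto
    have "q powr a \<le> q powr 1"
      using q assms by (intro powr_mono') auto
    also have "\<dots> \<le> q * (1 + q) powr (a - 1)"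
      using q one by simp
    finally have 2: "q powr a \<le> q * (1 + q) powr (a - 1)" .
    have 3: "q * (1 + q) powr (a - 1) \<le> a * q * (1 + q) powr (a - 1)"
      using q assms by simp
    have "g = (1 + q) powr (a - 1) - q * (1 + q) powr (a - 1) - 1 + q powr a"
      by (simp add: g_def algebra_simps)
    moreover have "q powr a \<ge> 0"
      by simp
    ultimately have "\<bar>g\<bar> \<le> a * q * (1 + q) powr (a - 1)"
      using 1 2 3 one by (intro abs_leI) linarith+
    then have "\<bar>exp (a * z) * g\<bar> \<le> remainder_bound a z"
      using z by (simp add: remainder_bound_eq q_def abs_mult)
    then show ?thesis
      using assms by (simp add: eq abs_mult)
  qed
  show ?thesis
  proof (cases "y \<ge> 0")
    case False
    have "remainder_bound a (- y) = remainder_bound a y"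
      by (simp add: remainder_bound_def)
    then show ?thesis
      using nonneg[of "- y"] False by (simp add: remainder_deriv_minus)
  qed (rule nonneg)
qed

text \<open>
  A caloric majorant of the remainder: expand \<open>(1 + q) powr (a - 1) \<le> (1 + q) ^ m\<close>, \<open>q = exp (- 2 \<bar>y\<bar>)\<close>,
  and keep only the lower half of the binomial sum, so that every rate \<open>\<bar>a - 2 - 2 i\<bar>\<close> stays below \<open>a\<close>.
\<close>

definition majorant_terms :: "real \<Rightarrow> nat" where
  "majorant_terms a = nat \<lceil>a - 1\<rceil>"

definition majorant :: "real \<Rightarrow> real \<Rightarrow> real \<Rightarrow> real" where
  "majorant a x t = (\<Sum>i\<le>majorant_terms a div 2. 2 * a * real (majorant_terms a choose i) *
     (exp ((a - 2 - 2 * real i) * x + (a - 2 - 2 * real i)\<^sup>2 * t) +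
      exp (- (a - 2 - 2 * real i) * x + (- (a - 2 - 2 * real i))\<^sup>2 * t)))"

lemma majorant_terms:
  assumes "a \<ge> 1"
  shows "a - 1 \<le> real (majorant_terms a)" "real (majorant_terms a) < a"
  using assms by (auto simp: majorant_terms_def) linarith+

lemma heat_solution_majorant: "heat_solution (majorant a)"
  unfolding majorant_def
  by (intro heat_solution_sum heat_solution_scale heat_solution_add heat_solution_exp)

lemma majorant_nonneg: "a \<ge> 0 \<Longrightarrow> majorant a x t \<ge> 0"
  unfolding majorant_def by (intro sum_nonneg mult_nonneg_nonneg add_nonneg_nonneg) auto

text \<open>The product \<open>exp (a * \<bar>y\<bar>) * q * q ^ i\<close> is an exponential in
  \<open>\<bar>y\<bar>\<close> of rate \<open>a - 2 - 2 * i\<close>. Replacing it by the sum over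
  both signs of \<open>y\<close> makes it the initial value of a caloric function. In the
  coefficient \<open>2 * a\<close>, the 2 pays for the discarded upper half of the binomial
  sum.\<close>

lemma remainder_bound_le_majorant:
  assumes "a \<ge> 1"
  shows "remainder_bound a y \<le> majorant a y 0"
proof -
  define q where "q = exp (- 2 * \<bar>y\<bar>)"
  define m where "m = majorant_terms a"
  have q: "0 < q" "q \<le> 1"
    by (auto simp: q_def)
  have exp_abs_le: "exp (b * \<bar>y\<bar>) \<le> exp (b * y) + exp (- b * y)" for b
    by (cases "y \<ge> 0") simp_all
  have "(1 + q) powr (a - 1) \<le> (1 + q) powr real m"
    using q majorant_terms[OF assms] by (intro powr_mono) (auto simp: m_def)
  also have "\<dots> = (1 + q) ^ m"
    using q by (simp add: powr_realpow)
  also have "\<dots> \<le> 2 * (\<Sum>i\<le>m div 2. real (m choose i) * q ^ i)"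
    by (rule power_one_plus_le_lower_half[OF q])
  finally have "remainder_bound a y \<le> exp (a * \<bar>y\<bar>) * (a * q * (2 * (\<Sum>i\<le>m div 2. real (m choose i) * q ^ i)))"
    unfolding remainder_bound_eq q_def[symmetric] using assms q by (intro mult_left_mono) auto
  also have "\<dots> = (\<Sum>i\<le>m div 2. 2 * a * real (m choose i) * (exp (a * \<bar>y\<bar>) * q * q ^ i))"
    by (simp add: sum_distrib_left mult_ac)
  also have "\<dots> \<le> majorant a y 0"
    unfolding majorant_def m_def[symmetric]
  proof (intro sum_mono mult_left_mono)
    fix i
    have "exp (a * \<bar>y\<bar>) * q * q ^ i = exp ((a - 2 - 2 * real i) * \<bar>y\<bar>)"
      by (simp add: q_def exp_of_nat_mult[symmetric] exp_add[symmetric] algebra_simps)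
    also have "\<dots> \<le> exp ((a - 2 - 2 * real i) * y) + exp (- (a - 2 - 2 * real i) * y)"
      by (rule exp_abs_le)
    finally show "exp (a * \<bar>y\<bar>) * q * q ^ i \<le> exp ((a - 2 - 2 * real i) * y + (a - 2 - 2 * real i)\<^sup>2 * 0) +
        exp (- (a - 2 - 2 * real i) * y + (- (a - 2 - 2 * real i))\<^sup>2 * 0)"
      by simp
  qed (use assms in auto)
  finally show ?thesis .
qed

lemma majorant_rate:
  assumes "a \<ge> 2" "i \<le> majorant_terms a div 2"
  shows "\<bar>a - 2 - 2 * real i\<bar> \<le> a" "2 * real i \<le> a"
proof -
  have "2 * i \<le> majorant_terms a"
    using assms(2) by simp
  then have "2 * real i \<le> real (majorant_terms a)"
    by linarith
  then show "\<bar>a - 2 - 2 * real i\<bar> \<le> a" "2 * real i \<le> a"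
    using majorant_terms(2)[of a] assms(1) by linarith+
qed

text \<open>Serves to move an intermediate point of the mean value theorem back to \<open>x\<close>,
  at a cost that tends to 1 with the step size.\<close>

lemma majorant_shift_le:
  assumes "a \<ge> 2" "s \<ge> 0"
  shows "majorant a (x + s) t \<le> exp (a * s) * majorant a x t"
  unfolding majorant_def sum_distrib_left
proof (rule sum_mono)
  fix i assume "i \<in> {..majorant_terms a div 2}"
  then have b: "\<bar>a - 2 - 2 * real i\<bar> \<le> a"
    using majorant_rate(1)[OF assms(1)] by simp
  have *: "exp (b * (x + s) + c) \<le> exp (a * s) * exp (b * x + c)" if "b \<le> a" for b c
    using mult_right_mono[OF that assms(2)] by (simp add: exp_add[symmetric] algebra_simps)
  define b where "b = a - 2 - 2 * real i"
  have "exp (b * (x + s) + b\<^sup>2 * t) + exp (- b * (x + s) + (- b)\<^sup>2 * t) \<le>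
      exp (a * s) * (exp (b * x + b\<^sup>2 * t) + exp (- b * x + (- b)\<^sup>2 * t))"
    unfolding distrib_left[of "exp (a * s)"]
    by (intro add_mono *) (use b in \<open>auto simp: b_def\<close>)
  then have "2 * a * real (majorant_terms a choose i) *
      (exp (b * (x + s) + b\<^sup>2 * t) + exp (- b * (x + s) + (- b)\<^sup>2 * t)) \<le>
      2 * a * real (majorant_terms a choose i) *
      (exp (a * s) * (exp (b * x + b\<^sup>2 * t) + exp (- b * x + (- b)\<^sup>2 * t)))"
    using assms by (intro mult_left_mono) auto
  then show "2 * a * real (majorant_terms a choose i) *
      (exp ((a - 2 - 2 * real i) * (x + s) + (a - 2 - 2 * real i)\<^sup>2 * t) +
       exp (- (a - 2 - 2 * real i) * (x + s) + (- (a - 2 - 2 * real i))\<^sup>2 * t)) \<le>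
      exp (a * s) * (2 * a * real (majorant_terms a choose i) *
      (exp ((a - 2 - 2 * real i) * x + (a - 2 - 2 * real i)\<^sup>2 * t) +
       exp (- (a - 2 - 2 * real i) * x + (- (a - 2 - 2 * real i))\<^sup>2 * t)))"
    unfolding b_def[symmetric] by (simp only: mult_ac)
qed

section \<open>The leading wave and its dominance over the majorant\<close>

definition two_wave :: "real \<Rightarrow> real \<Rightarrow> real \<Rightarrow> real" where
  "two_wave a x t = exp (a * x + a\<^sup>2 * t) + exp (- a * x + (- a)\<^sup>2 * t)"

lemma heat_solution_two_wave: "heat_solution (two_wave a)"
  unfolding two_wave_def by (intro heat_solution_add heat_solution_exp)

lemma two_wave_eq: "two_wave a x t = exp (a\<^sup>2 * t) * (2 * cosh (a * x))"
  by (simp only: two_wave_def two_cosh_eq exp_add distrib_left power2_minus mult_minus_left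
      mult.commute[of "exp (_ * x)"] mult.commute[of "exp (- _)"])

lemma two_wave_pos: "two_wave a x t > 0"
  by (simp add: two_wave_def add_pos_pos)

lemma DERIV_two_wave:
  "((\<lambda>x. two_wave a x t) has_real_derivative a * tanh (a * x) * two_wave a x t) (at x)"
proof -
  have "((\<lambda>x. two_wave a x t) has_real_derivative exp (a\<^sup>2 * t) * (2 * (sinh (a * x) * a))) (at x)"
    unfolding two_wave_eq by (auto intro!: derivative_eq_intros)
  moreover have "exp (a\<^sup>2 * t) * (2 * (sinh (a * x) * a)) = a * tanh (a * x) * two_wave a x t"
    unfolding two_wave_eq tanh_def by (simp add: less_imp_neq[OF cosh_real_pos, symmetric])
  ultimately show ?thesis
    by simp
qed

lemma geometric_sum_le_two:
  fixes z :: real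
  assumes "0 \<le> z" "z \<le> 1 / 2"
  shows "(\<Sum>i\<le>n. z ^ i) \<le> 2"
proof -
  have "(\<Sum>i\<le>n. z ^ i) \<le> (\<Sum>i. z ^ i)"
    by (rule sum_le_suminf) (use assms in \<open>auto intro!: summable_geometric\<close>)
  also have "\<dots> = 1 / (1 - z)"
    by (rule suminf_geometric) (use assms in auto)
  also have "\<dots> \<le> 2"
    using assms by (simp add: field_simps)
  finally show ?thesis .
qed

text \<open>For the \<open>i\<close>-th rate \<open>b\<close>, the gap
  \<open>a\<^sup>2 - b\<^sup>2\<close> is \<open>4 * (a - 1)\<close> plus
  \<open>4 * i * (a - 2 - i)\<close>, and \<open>2 * i \<le> a\<close> bounds the latter below by
  \<open>i * (2 * a - 8)\<close>. The binomial coefficient is at most \<open>a ^ i\<close>, so the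
  sum is dominated by a geometric one of ratio \<open>z \<le> 1 / 2\<close>, whose value is at most
  2.\<close>

lemma majorant_le_two_wave:
  assumes a: "a \<ge> 4" and t: "t \<ge> 0" and small: "a * exp (- (2 * a - 8) * t) \<le> 1 / 2"
  shows "majorant a x t \<le> 4 * a * exp (- 4 * (a - 1) * t) * two_wave a x t"
proof -
  define m where "m = majorant_terms a"
  define z where "z = a * exp (- (2 * a - 8) * t)"
  have z: "0 \<le> z" "z \<le> 1 / 2"
    using a small by (auto simp: z_def)
  have "majorant a x t \<le> (\<Sum>i\<le>m div 2. 2 * a * exp (- 4 * (a - 1) * t) * two_wave a x t * z ^ i)"
    unfolding majorant_def m_def[symmetric]
  proof (rule sum_mono)
    fix i assume "i \<in> {..m div 2}"
    then have i: "i \<le> m div 2" by simp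
    define b where "b = a - 2 - 2 * real i"
    have b: "\<bar>b\<bar> \<le> a" "2 * real i \<le> a"
      using majorant_rate[of a i] a i by (auto simp: b_def m_def)
    have "i \<le> m"
      using i by simp
    then have "real (m choose i) \<le> real (m ^ i)"
      using binomial_le_pow of_nat_mono by blast
    also have "\<dots> \<le> a ^ i"
      using majorant_terms(2)[of a] a by (auto simp: m_def intro!: power_mono)
    finally have choose: "real (m choose i) \<le> a ^ i" .
    have "cosh \<bar>b * x\<bar> \<le> cosh \<bar>a * x\<bar>"
      using b(1) a by (subst cosh_real_nonneg_le_iff) (auto simp: abs_mult intro: mult_right_mono)
    then have cosh: "2 * cosh (b * x) \<le> 2 * cosh (a * x)"
      by simp
    have "a\<^sup>2 - b\<^sup>2 = 4 * (a - 1) + 4 * real i * (a - 2 - real i)"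
      by (simp add: b_def power2_eq_square algebra_simps)
    moreover have "real i * (2 * a - 8) \<le> 4 * real i * (a - 2 - real i)"
      using b(2) mult_left_mono[of "2 * a - 8" "4 * (a - 2 - real i)" "real i"] by (simp add: mult_ac)
    ultimately have "b\<^sup>2 \<le> a\<^sup>2 + - 4 * (a - 1) + real i * (- (2 * a - 8))"
      by (simp add: algebra_simps)
    then have "b\<^sup>2 * t \<le> (a\<^sup>2 + - 4 * (a - 1) + real i * (- (2 * a - 8))) * t"
      using t by (rule mult_right_mono)
    also have "\<dots> = a\<^sup>2 * t + - 4 * (a - 1) * t + real i * (- (2 * a - 8) * t)"
      by (simp only: distrib_right mult.assoc)
    finally have "exp (b\<^sup>2 * t) \<le> exp (a\<^sup>2 * t) * exp (- 4 * (a - 1) * t) * exp (- (2 * a - 8) * t) ^ i"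
      by (simp only: exp_of_nat_mult[symmetric] exp_add[symmetric] exp_le_cancel_iff)
    then have "exp (b\<^sup>2 * t) * (2 * cosh (b * x)) \<le>
        exp (a\<^sup>2 * t) * exp (- 4 * (a - 1) * t) * exp (- (2 * a - 8) * t) ^ i * (2 * cosh (a * x))"
      using cosh by (rule mult_mono) auto
    moreover have "exp (b * x + b\<^sup>2 * t) + exp (- b * x + (- b)\<^sup>2 * t) = exp (b\<^sup>2 * t) * (2 * cosh (b * x))"
      using two_wave_eq[of b x t] by (simp add: two_wave_def)
    ultimately have "2 * a * real (m choose i) * (exp (b * x + b\<^sup>2 * t) + exp (- b * x + (- b)\<^sup>2 * t)) \<le>
       2 * a * a ^ i * (exp (a\<^sup>2 * t) * exp (- 4 * (a - 1) * t) * exp (- (2 * a - 8) * t) ^ i * (2 * cosh (a * x)))"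
      using a choose by (intro mult_mono) (auto intro!: add_nonneg_nonneg)
    also have "\<dots> = 2 * a * exp (- 4 * (a - 1) * t) * two_wave a x t * z ^ i"
      unfolding two_wave_eq z_def power_mult_distrib by (simp only: mult_ac)
    finally show "2 * a * real (m choose i) * (exp ((a - 2 - 2 * real i) * x + (a - 2 - 2 * real i)\<^sup>2 * t) +
        exp (- (a - 2 - 2 * real i) * x + (- (a - 2 - 2 * real i))\<^sup>2 * t)) \<le>
        2 * a * exp (- 4 * (a - 1) * t) * two_wave a x t * z ^ i"
      unfolding b_def .
  qed
  also have "\<dots> = 2 * a * exp (- 4 * (a - 1) * t) * two_wave a x t * (\<Sum>i\<le>m div 2. z ^ i)"
    by (simp only: sum_distrib_left)
  also have "\<dots> \<le> 2 * a * exp (- 4 * (a - 1) * t) * two_wave a x t * 2"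
    using a two_wave_pos[of a x t] by (intro mult_left_mono geometric_sum_le_two z) auto
  finally show ?thesis
    by simp
qed

section \<open>Distance to the shock\<close>

lemma two_wave_estimates:
  assumes a: "a \<ge> 2" and \<phi>: "heat_solution \<phi>" and nonneg: "\<And>x t. 0 \<le> t \<Longrightarrow> \<phi> x t \<ge> 0"
    and init: "\<And>x. \<phi> x 0 = (2 * cosh x) powr a" and t: "t \<ge> 0"
  shows "two_wave a x t \<le> \<phi> x t"
    and "\<phi> x t \<le> two_wave a x t + majorant a x t"
    and "((\<lambda>y. \<phi> y t) has_real_derivative \<phi>') (at x) \<Longrightarrow>
      \<bar>\<phi>' - a * tanh (a * x) * two_wave a x t\<bar> \<le> a * majorant a x t"
proof -
  have a1: "a \<ge> 1" "a \<ge> 0"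
    using a by auto
  note W_nonneg = less_imp_le[OF two_wave_pos[of a]] and M_nonneg = majorant_nonneg[OF a1(2)]
  have W0: "two_wave a x 0 = exp (a * x) + exp (- a * x)" for x
    by (simp add: two_wave_def)
  have M0: "remainder_bound a x \<le> majorant a x 0" for x
    by (rule remainder_bound_le_majorant[OF a1(1)])
  show "two_wave a x t \<le> \<phi> x t"
  proof (rule positive_heat_solution_comparison[OF heat_solution_two_wave \<phi> W_nonneg nonneg _ t])
    show "two_wave a x 0 \<le> \<phi> x 0" for x
      unfolding W0 init by (rule two_cosh_powr_ge[OF a1(1)])
  qed
  show "\<phi> x t \<le> two_wave a x t + majorant a x t"
  proof (rule positive_heat_solution_comparison[OF \<phi> heat_solution_add[OF heat_solution_two_wave heat_solution_majorant]
        nonneg add_nonneg_nonneg[OF W_nonneg M_nonneg] _ t])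
    show "\<phi> x 0 \<le> two_wave a x 0 + majorant a x 0" for x
      unfolding W0 init using two_cosh_powr_le[OF a1(1), of x] M0[of x] by linarith
  qed

  define R where "R x t = \<phi> x t - two_wave a x t" for x t
  have diff: "\<bar>R (x + s) t - R x t\<bar> \<le> s * (a * exp (a * s)) * majorant a x t" if s: "s > 0" for s
  proof -
    have shift: "heat_solution (\<lambda>x t. p (x + s) t)" if "heat_solution p" for p
      using heat_solution_affine[OF that, of 1 s] by simp
    define k where "k = s * (a * exp (a * s))"
    have k: "k \<ge> 0"
      using s a1 by (simp add: k_def)
    have R0: "\<bar>R (x + s) 0 - R x 0\<bar> \<le> k * majorant a x 0" for x
    proof -
      have R: "R y 0 = (2 * cosh y) powr a - (exp (a * y) + exp (- a * y))" for y
        by (simp_all add: R_def init W0)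
      have "\<exists>z>x. z < x + s \<and> R (x + s) 0 - R x 0 = (x + s - x) * remainder_deriv a z"
        unfolding R by (rule MVT2[OF _ DERIV_remainder]) (use s in simp)
      then obtain z where z: "x < z" "z < x + s" "R (x + s) 0 - R x 0 = s * remainder_deriv a z"
        by auto
      have "\<bar>remainder_deriv a z\<bar> \<le> a * majorant a z 0"
        using remainder_deriv_bound[OF a1(1), of z] mult_left_mono[OF M0[of z] a1(2)] by linarith
      also have "majorant a z 0 \<le> exp (a * (z - x)) * majorant a x 0"
        using majorant_shift_le[OF a, of "z - x" x 0] z by simp
      also have "\<dots> \<le> exp (a * s) * majorant a x 0"
        using z a1 M_nonneg by (intro mult_right_mono) (auto intro!: mult_left_mono)
      finally have "\<bar>remainder_deriv a z\<bar> \<le> a * (exp (a * s) * majorant a x 0)"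
        using a1 by (simp add: mult_left_mono)
      then show ?thesis
        using s by (simp add: z(3) abs_mult k_def mult.assoc)
    qed
    \<comment> \<open>The inequality for differences is rearranged so that both sides are sums of
      nonnegative solutions, as comparison demands.\<close>
    have "\<phi> (x + s) t + two_wave a x t \<le> \<phi> x t + two_wave a (x + s) t + k * majorant a x t"
      by (rule positive_heat_solution_comparison[where p = "\<lambda>x t. \<phi> (x + s) t + two_wave a x t" and
            q = "\<lambda>x t. \<phi> x t + two_wave a (x + s) t + k * majorant a x t"])
        (use R0 t in \<open>auto intro!: heat_solution_add heat_solution_scale shift \<phi> heat_solution_two_wave
          heat_solution_majorant add_nonneg_nonneg mult_nonneg_nonneg nonneg W_nonneg M_nonneg k
          simp: R_def abs_le_iff algebra_simps\<close>)
    moreover have "\<phi> x t + two_wave a (x + s) t \<le> \<phi> (x + s) t + two_wave a x t + k * majorant a x t"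
      by (rule positive_heat_solution_comparison[where p = "\<lambda>x t. \<phi> x t + two_wave a (x + s) t" and
            q = "\<lambda>x t. \<phi> (x + s) t + two_wave a x t + k * majorant a x t"])
        (use R0 t in \<open>auto intro!: heat_solution_add heat_solution_scale shift \<phi> heat_solution_two_wave
          heat_solution_majorant add_nonneg_nonneg mult_nonneg_nonneg nonneg W_nonneg M_nonneg k
          simp: R_def abs_le_iff algebra_simps\<close>)
    ultimately show ?thesis
      unfolding k_def[symmetric] R_def by linarith
  qed
  assume "((\<lambda>y. \<phi> y t) has_real_derivative \<phi>') (at x)"
  then have "((\<lambda>y. R y t) has_real_derivative \<phi>' - a * tanh (a * x) * two_wave a x t) (at x)"
    unfolding R_def by (intro DERIV_diff DERIV_two_wave)
  \<comment> \<open>In the limit of small \<open>s > 0\<close> the difference quotient becomes the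
    derivative and the shift factor \<open>exp (a * s)\<close> becomes 1.\<close>
  then have "((\<lambda>s. (R (x + s) t - R x t) / s) \<longlongrightarrow> \<phi>' - a * tanh (a * x) * two_wave a x t) (at 0)"
    by (simp add: DERIV_def)
  then have "((\<lambda>s. \<bar>(R (x + s) t - R x t) / s\<bar>) \<longlongrightarrow> \<bar>\<phi>' - a * tanh (a * x) * two_wave a x t\<bar>) (at_right 0)"
    by (intro tendsto_rabs) (simp add: filterlim_at_split)
  moreover have "((\<lambda>s. a * exp (a * s) * majorant a x t) \<longlongrightarrow> a * exp (a * 0) * majorant a x t) (at_right 0)"
    by (intro tendsto_intros)
  moreover have "eventually (\<lambda>s. \<bar>(R (x + s) t - R x t) / s\<bar> \<le> a * exp (a * s) * majorant a x t) (at_right 0)"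
    using eventually_at_right_less[of "0::real"]
  proof eventually_elim
    case (elim s)
    then show ?case
      using diff[of s] by (simp add: divide_le_eq mult_ac)
  qed
  ultimately have "\<bar>\<phi>' - a * tanh (a * x) * two_wave a x t\<bar> \<le> a * exp (a * 0) * majorant a x t"
    by (intro tendsto_le[of "at_right (0::real)"]) auto
  then show "\<bar>\<phi>' - a * tanh (a * x) * two_wave a x t\<bar> \<le> a * majorant a x t"
    by simp
qed

text \<open>With \<open>\<tau> = tanh (a * x)\<close>, \<open>(w - a * \<tau>) * \<phi>\<close>
  splits into the error of the derivative and \<open>a * \<tau>\<close> times the error of
  \<open>\<phi>\<close>. Each is at most \<open>a * M\<close>, and division by
  \<open>W \<le> \<phi>\<close> removes the exponential growth in \<open>x\<close>.\<close>

lemma log_derivative_estimate: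
  assumes a: "a \<ge> 4" and \<phi>: "heat_solution \<phi>" and nonneg: "\<And>x t. 0 \<le> t \<Longrightarrow> \<phi> x t \<ge> 0"
    and init: "\<And>x. \<phi> x 0 = (2 * cosh x) powr a" and t: "t \<ge> 0"
    and small: "a * exp (- (2 * a - 8) * t) \<le> 1 / 2"
    and deriv: "((\<lambda>y. \<phi> y t) has_real_derivative w * \<phi> x t) (at x)"
  shows "\<bar>w - a * tanh (a * x)\<bar> \<le> 8 * a\<^sup>2 * exp (- 4 * (a - 1) * t)"
proof -
  define W M \<tau> where "W = two_wave a x t" and "M = majorant a x t" and "\<tau> = tanh (a * x)"
  have a2: "a \<ge> 2"
    using a by simp
  note est = two_wave_estimates[OF a2 \<phi> nonneg init t, where x = x]
  have W: "W > 0" "W \<le> \<phi> x t" "\<phi> x t \<le> W + M"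
    using est(1,2) two_wave_pos by (auto simp: W_def M_def)
  have d: "\<bar>w * \<phi> x t - a * \<tau> * W\<bar> \<le> a * M"
    using est(3)[OF _ deriv] by (simp add: W_def M_def \<tau>_def)
  have \<tau>: "\<bar>\<tau>\<bar> \<le> 1"
    using tanh_real_bounds[of "a * x"] by (auto simp: \<tau>_def)
  have "\<bar>w - a * \<tau>\<bar> * W \<le> \<bar>w - a * \<tau>\<bar> * \<phi> x t"
    using W by (intro mult_left_mono) auto
  also have "\<dots> = \<bar>(w * \<phi> x t - a * \<tau> * W) + - (a * \<tau>) * (\<phi> x t - W)\<bar>"
  proof -
    have "\<bar>w - a * \<tau>\<bar> * \<phi> x t = \<bar>(w - a * \<tau>) * \<phi> x t\<bar>"
      using W by (simp add: abs_mult)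
    then show ?thesis
      by (simp add: algebra_simps)
  qed
  also have "\<dots> \<le> \<bar>w * \<phi> x t - a * \<tau> * W\<bar> + \<bar>- (a * \<tau>) * (\<phi> x t - W)\<bar>"
    by (rule abs_triangle_ineq)
  also have "\<bar>- (a * \<tau>) * (\<phi> x t - W)\<bar> = a * (\<bar>\<tau>\<bar> * (\<phi> x t - W))"
    using W a by (simp add: abs_mult)
  also have "\<bar>w * \<phi> x t - a * \<tau> * W\<bar> + a * (\<bar>\<tau>\<bar> * (\<phi> x t - W)) \<le> a * M + a * (1 * M)"
    using W a \<tau> d by (intro add_mono mult_left_mono mult_mono) auto
  also have "\<dots> = 2 * a * M"
    by simp
  also have "\<dots> \<le> 2 * a * (4 * a * exp (- 4 * (a - 1) * t) * W)"
    unfolding M_def W_def using a by (intro mult_left_mono majorant_le_two_wave t small) auto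
  also have "\<dots> = 8 * a\<^sup>2 * exp (- 4 * (a - 1) * t) * W"
    by (simp add: power2_eq_square)
  finally show ?thesis
    using W(1) by (simp add: \<tau>_def)
qed

section \<open>Return to the Burgers equation\<close>

lemma DERIV_ln_cosh: "((\<lambda>y. ln (cosh y)) has_real_derivative tanh y) (at y)" for y :: real
  by (auto intro!: derivative_eq_intros simp: cosh_real_pos tanh_def)

text \<open>At the rescaled point \<open>(l * x, l\<^sup>2 * t)\<close> the logarithmic derivative
  of the transform is \<open>- u x t / l\<close>, and \<open>a * l = 4 * k\<close> identifies
  \<open>l * a * tanh (a * l * x)\<close> with \<open>- u_infinity k x\<close>. This explains the
  prefactor \<open>l\<close>.\<close>

lemma burgers_tanh_estimate:
  assumes l: "l > 0" and a: "a = 4 * k / l" "a \<ge> 4"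
    and u: "burgers_ivp_solution (\<lambda>x. - 4 * k * tanh (l * x)) u"
    and t: "t > 0" and small: "a * exp (- (2 * a - 8) * (l\<^sup>2 * t)) \<le> 1 / 2"
  shows "\<bar>u x t - u_infinity k x\<bar> \<le> l * (8 * a\<^sup>2 * exp (- 4 * (a - 1) * (l\<^sup>2 * t)))"
proof -
  have k: "4 * k = a * l"
    using a l by simp
  obtain \<phi> c where \<phi>: "heat_solution \<phi>" "\<And>x t. \<phi> x t > 0"
      "\<And>x t. t > 0 \<Longrightarrow> ((\<lambda>y. \<phi> y t) has_real_derivative - u x t * \<phi> x t) (at x)"
      "\<And>x. \<phi> x 0 = c * exp (- (x * integral {0..1} (\<lambda>r. - 4 * k * tanh (l * (r * x)))))"
    using cole_hopf[OF u] by blast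
  have \<phi>0: "\<phi> x 0 = c * cosh (l * x) powr a" for x
  proof -
    have "integral {0..1} (\<lambda>r. x * (- 4 * k * tanh (l * (r * x)))) =
        - a * ln (cosh (l * (1 * x))) - - a * ln (cosh (l * (0 * x)))"
    proof (rule integral_FTC_unit)
      fix r :: real
      have "((\<lambda>r. l * (r * x)) has_real_derivative l * x) (at r)"
        by (auto intro!: derivative_eq_intros)
      from DERIV_cmult[OF DERIV_chain2[OF DERIV_ln_cosh this], of "- a"]
      have "((\<lambda>r. - a * ln (cosh (l * (r * x)))) has_real_derivative - a * (tanh (l * (r * x)) * (l * x))) (at r)" .
      moreover have "- a * (tanh (l * (r * x)) * (l * x)) = x * (- 4 * k * tanh (l * (r * x)))"
        using k by (simp add: mult_ac)
      ultimately show "((\<lambda>r. - a * ln (cosh (l * (r * x)))) has_real_derivative x * (- 4 * k * tanh (l * (r * x)))) (at r)"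
        by (rule DERIV_cong)
    qed
    then have "- (x * integral {0..1} (\<lambda>r. - 4 * k * tanh (l * (r * x)))) = a * ln (cosh (l * x))"
      unfolding integral_mult_right by simp
    then show ?thesis
      unfolding \<phi>(4) by (simp add: powr_def cosh_real_pos less_imp_neq[OF cosh_real_pos, symmetric])
  qed
  have c: "c > 0"
    using \<phi>(2)[of 0 0] \<phi>0[of 0] by simp
  \<comment> \<open>The constant cancels the unknown \<open>c\<close> and supplies the factor 2 in
    \<open>(2 * cosh x) powr a\<close>.\<close>
  define \<Phi> where "\<Phi> x t = 2 powr a / c * \<phi> (x / l) (t / l\<^sup>2)" for x t
  have "heat_solution (\<lambda>x t. \<phi> (x / l) (t / l\<^sup>2))"
    using heat_solution_affine[OF \<phi>(1), of "1 / l" 0] l by (simp add: power_divide)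
  then have heat: "heat_solution \<Phi>"
    unfolding \<Phi>_def by (rule heat_solution_scale)
  have nonneg: "\<Phi> x t \<ge> 0" for x t
    using \<phi>(2)[of "x / l" "t / l\<^sup>2"] c by (simp add: \<Phi>_def)
  have init: "\<Phi> x 0 = (2 * cosh x) powr a" for x
    using c l by (simp add: \<Phi>_def \<phi>0 powr_mult cosh_real_pos less_imp_le)
  have deriv: "((\<lambda>y. \<Phi> y (l\<^sup>2 * t)) has_real_derivative (- u x t / l) * \<Phi> (l * x) (l\<^sup>2 * t)) (at (l * x))"
  proof -
    have "((\<lambda>y. y / l) has_real_derivative 1 / l) (at (l * x))"
      using l by (auto intro!: derivative_eq_intros)
    moreover have "((\<lambda>y. \<phi> y t) has_real_derivative - u x t * \<phi> x t) (at (l * x / l))"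
      using \<phi>(3)[OF t, of x] l by simp
    ultimately have "((\<lambda>y. \<phi> (y / l) t) has_real_derivative - u x t * \<phi> x t * (1 / l)) (at (l * x))"
      using DERIV_chain2[of "\<lambda>y. \<phi> y t" _ "\<lambda>y. y / l" "l * x" "1 / l"] by blast
    from DERIV_cmult[OF this, of "2 powr a / c"] show ?thesis
      using l by (simp add: \<Phi>_def mult_ac)
  qed
  have "\<bar>- u x t / l - a * tanh (a * (l * x))\<bar> \<le> 8 * a\<^sup>2 * exp (- 4 * (a - 1) * (l\<^sup>2 * t))"
    by (rule log_derivative_estimate[OF a(2) heat nonneg init _ small deriv]) (use t in simp)
  then have "l * \<bar>- u x t / l - a * tanh (a * (l * x))\<bar> \<le> l * (8 * a\<^sup>2 * exp (- 4 * (a - 1) * (l\<^sup>2 * t)))"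
    using l by (intro mult_left_mono) auto
  moreover have "l * \<bar>- u x t / l - a * tanh (a * (l * x))\<bar> = \<bar>l * (- u x t / l - a * tanh (a * (l * x)))\<bar>"
    using l by (simp add: abs_mult)
  moreover have "l * (- u x t / l - a * tanh (a * (l * x))) = - (u x t - u_infinity k x)"
    using l k by (simp add: u_infinity_def algebra_simps)
  ultimately show ?thesis
    by (simp only: abs_minus_cancel)
qed

text \<open>The margin \<open>1 + 4 \<delta> + 2 \<delta>\<^sup>2\<close> against \<open>3 \<delta> + \<delta>\<^sup>2\<close> in the powers of \<open>a\<close> leaves room to spend
  one factor \<open>exp (- a s)\<close> on \<open>sqrt s\<close>.\<close>

lemma decay_estimate:
  fixes a s \<delta> :: real
  assumes \<delta>: "\<delta> > 0" and a: "a \<ge> 4 * (1 + \<delta>)\<^sup>2 / \<delta>\<^sup>2" "a \<ge> 4"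
    and s: "s \<ge> (1 + \<delta>)\<^sup>2 * ln a / (2 * a)"
  shows "8 * a\<^sup>2 * exp (- 4 * (a - 1) * s) \<le> 8 / (a powr (3 * \<delta> + \<delta>\<^sup>2) * sqrt s)"
proof -
  have s0: "s > 0"
    by (rule less_le_trans[OF _ s]) (use a \<delta> in simp)
  have "sqrt (a * s) \<le> exp (a * s)"
  proof (rule real_le_lsqrt)
    have "a * s > 0"
      using s0 a by simp
    then have "a * s \<le> exp (a * s)" "1 \<le> exp (a * s)"
      using exp_ge_add_one_self[of "a * s"] by linarith+
    then have "a * s * 1 \<le> exp (a * s) * exp (a * s)"
      by (intro mult_mono) auto
    then show "a * s \<le> (exp (a * s))\<^sup>2"
      by (simp add: power2_eq_square)
  qed simp
  then have "sqrt s * sqrt a \<le> exp (a * s)"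
    by (simp add: real_sqrt_mult mult.commute)
  then have "sqrt s / exp (a * s) \<le> 1 / sqrt a"
    using a by (simp add: field_simps)
  moreover have "a powr (- 1 / 2) = 1 / sqrt a"
    using a powr_minus_divide[of a "1 / 2"] by (simp add: powr_half_sqrt)
  moreover have "sqrt s * exp (- (a * s)) = sqrt s / exp (a * s)"
    by (simp only: exp_minus divide_inverse)
  ultimately have 1: "sqrt s * exp (- (a * s)) \<le> a powr (- 1 / 2)"
    by linarith
  \<comment> \<open>Splitting \<open>4 * (a - 1) = a + (3 * a - 4)\<close>: the first part has
    absorbed \<open>sqrt s\<close>, the second has to produce the power of \<open>a\<close>.\<close>
  have "(3 * a - 4) * ((1 + \<delta>)\<^sup>2 * ln a / (2 * a)) \<le> (3 * a - 4) * s"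
    using s a by (intro mult_left_mono) auto
  moreover have "(3 * a - 4) * ((1 + \<delta>)\<^sup>2 * ln a / (2 * a)) = (3 / 2 * (1 + \<delta>)\<^sup>2 - 2 * (1 + \<delta>)\<^sup>2 / a) * ln a"
    using a by (simp add: field_simps)
  ultimately have "- ((3 * a - 4) * s) \<le> - (3 / 2 * (1 + \<delta>)\<^sup>2 - 2 * (1 + \<delta>)\<^sup>2 / a) * ln a"
    by linarith
  \<comment> \<open>The lower bound on \<open>a\<close> is chosen for this:
    \<open>3 / 2 * (1 + \<delta>)\<^sup>2 - \<delta>\<^sup>2 / 2\<close> is exactly
    \<open>3 / 2 + 3 * \<delta> + \<delta>\<^sup>2\<close>.\<close>
  moreover have "2 * (1 + \<delta>)\<^sup>2 / a \<le> \<delta>\<^sup>2 / 2"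
    using a \<delta> by (simp add: field_simps)
  then have "- (3 / 2 * (1 + \<delta>)\<^sup>2 - 2 * (1 + \<delta>)\<^sup>2 / a) \<le> - 3 / 2 - (3 * \<delta> + \<delta>\<^sup>2)"
    by (simp add: power2_eq_square algebra_simps)
  then have "- (3 / 2 * (1 + \<delta>)\<^sup>2 - 2 * (1 + \<delta>)\<^sup>2 / a) * ln a \<le> (- 3 / 2 - (3 * \<delta> + \<delta>\<^sup>2)) * ln a"
    using a by (intro mult_right_mono) auto
  ultimately have "exp (- ((3 * a - 4) * s)) \<le> exp ((- 3 / 2 - (3 * \<delta> + \<delta>\<^sup>2)) * ln a)"
    by simp
  then have 2: "exp (- ((3 * a - 4) * s)) \<le> a powr (- 3 / 2 - (3 * \<delta> + \<delta>\<^sup>2))"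
    using a by (simp add: powr_def)
  have "a\<^sup>2 * exp (- 4 * (a - 1) * s) * sqrt s = a\<^sup>2 * ((sqrt s * exp (- (a * s))) * exp (- ((3 * a - 4) * s)))"
  proof -
    have "- 4 * (a - 1) * s = - (a * s) + - ((3 * a - 4) * s)"
      by (simp add: algebra_simps)
    then show ?thesis
      by (simp only: exp_add mult_ac)
  qed
  also have "\<dots> \<le> a\<^sup>2 * (a powr (- 1 / 2) * a powr (- 3 / 2 - (3 * \<delta> + \<delta>\<^sup>2)))"
    by (intro mult_left_mono mult_mono 1 2) auto
  also have "\<dots> = a powr 2 * (a powr (- 1 / 2) * a powr (- 3 / 2 - (3 * \<delta> + \<delta>\<^sup>2)))"
    using a by simp
  also have "\<dots> = a powr (- (3 * \<delta> + \<delta>\<^sup>2))"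
    by (simp add: powr_add[symmetric])
  also have "\<dots> = 1 / a powr (3 * \<delta> + \<delta>\<^sup>2)"
    by (rule powr_minus_divide)
  finally have "a\<^sup>2 * exp (- 4 * (a - 1) * s) \<le> 1 / a powr (3 * \<delta> + \<delta>\<^sup>2) / sqrt s"
    using s0 by (subst pos_le_divide_eq) auto
  then show ?thesis
    by simp
qed

text \<open>One factor \<open>1 + \<delta>\<close> of the threshold compensates the 8 in
  \<open>2 * a - 8\<close>, because \<open>(1 + \<delta>) * (1 - 4 / a) \<ge> 1\<close> for large
  \<open>a\<close>. The other leaves \<open>a powr (- \<delta>)\<close>, which is at most
  \<open>1 / 2\<close> once \<open>a \<ge> 2 powr (1 / \<delta>)\<close>.\<close>

lemma small_ratio:
  fixes a s \<delta> :: real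
  assumes \<delta>: "\<delta> > 0" and a: "a \<ge> 4 * (1 + \<delta>)\<^sup>2 / \<delta>\<^sup>2" "a \<ge> 4" "a \<ge> 2 powr (1 / \<delta>)"
    and s: "s \<ge> (1 + \<delta>)\<^sup>2 * ln a / (2 * a)"
  shows "a * exp (- (2 * a - 8) * s) \<le> 1 / 2"
proof -
  have "a \<ge> 4 * (1 + \<delta>) / \<delta>"
  proof -
    have "4 * (1 + \<delta>) / \<delta> * 1 \<le> 4 * (1 + \<delta>) / \<delta> * ((1 + \<delta>) / \<delta>)"
      using \<delta> by (intro mult_left_mono) auto
    moreover have "4 * (1 + \<delta>) / \<delta> * ((1 + \<delta>) / \<delta>) = 4 * (1 + \<delta>)\<^sup>2 / \<delta>\<^sup>2"
      by (simp add: power2_eq_square)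
    ultimately show ?thesis
      using a(1) by linarith
  qed
  then have "4 * (1 + \<delta>) \<le> \<delta> * a"
    using \<delta> by (simp add: field_simps)
  then have "(1 + \<delta>) * 1 \<le> (1 + \<delta>) * ((1 + \<delta>) * (1 - 4 / a))"
    using \<delta> a(2) by (intro mult_left_mono) (auto simp: field_simps)
  then have "(1 + \<delta>) * ln a \<le> (1 + \<delta>) * ((1 + \<delta>) * (1 - 4 / a)) * ln a"
    using a(2) by (intro mult_right_mono) auto
  also have "\<dots> = (2 * a - 8) * ((1 + \<delta>)\<^sup>2 * ln a / (2 * a))"
    using a(2) by (simp add: field_simps power2_eq_square)
  also have "\<dots> \<le> (2 * a - 8) * s"
    using s a by (intro mult_left_mono) auto
  finally have "exp (- (2 * a - 8) * s) \<le> exp (- (1 + \<delta>) * ln a)"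
    by (simp only: exp_le_cancel_iff mult_minus_left neg_le_iff_le)
  also have "\<dots> = a powr (- (1 + \<delta>))"
    using a(2) by (simp add: powr_def)
  finally have "a * exp (- (2 * a - 8) * s) \<le> a powr 1 * a powr (- (1 + \<delta>))"
    using a(2) by (simp add: mult_left_mono)
  also have "\<dots> = 1 / a powr \<delta>"
  proof -
    have "1 + - (1 + \<delta>) = - \<delta>"
      by simp
    then show ?thesis
      by (simp only: powr_add[symmetric] powr_minus_divide[symmetric])
  qed
  also have "\<dots> \<le> 1 / 2"
  proof -
    have "(2 powr (1 / \<delta>)) powr \<delta> \<le> a powr \<delta>"
      using a(3) \<delta> by (intro powr_mono2) auto
    then have "2 \<le> a powr \<delta>"
      using \<delta> by (simp add: powr_powr)
    then show ?thesis
      by (intro divide_left_mono) auto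
  qed
  finally show ?thesis .
qed

theorem corollary3:
  fixes \<delta> :: real
  assumes "\<delta> > 0"
  shows "\<exists>A>0. \<exists>C>0. \<forall>k l a :: real. \<forall>u.
           k > 0 \<longrightarrow> l > 0 \<longrightarrow> a = 4 * k / l \<longrightarrow>
           burgers_ivp_solution (\<lambda>x. - 4 * k * tanh (l * x)) u \<longrightarrow>
           shock_boundary_conditions k u \<longrightarrow>
           a \<ge> A \<longrightarrow>
           (\<forall>t \<ge> T_star \<delta> k a.
              (SUP x. ereal \<bar>u x t - u_infinity k x\<bar>)
                \<le> ereal (C / (a powr (3 * \<delta> + \<delta>\<^sup>2) * sqrt t)))"
proof -
  define A where "A = Max {4, 4 * (1 + \<delta>)\<^sup>2 / \<delta>\<^sup>2, 2 powr (1 / \<delta>)}"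
  have A: "A \<ge> 4" "A \<ge> 4 * (1 + \<delta>)\<^sup>2 / \<delta>\<^sup>2" "A \<ge> 2 powr (1 / \<delta>)"
    by (simp_all add: A_def)
  show ?thesis
  proof (rule exI[of _ A], rule conjI, use A in simp, rule exI[of _ 8], rule conjI, simp, intro allI impI)
    fix k l a :: real and u t
    assume k: "k > 0" and l: "l > 0" and a: "a = 4 * k / l"
      and u: "burgers_ivp_solution (\<lambda>x. - 4 * k * tanh (l * x)) u"
      and aA: "a \<ge> A" and t: "T_star \<delta> k a \<le> t"
    have a4: "a \<ge> 4" "a \<ge> 4 * (1 + \<delta>)\<^sup>2 / \<delta>\<^sup>2" "a \<ge> 2 powr (1 / \<delta>)"
      using A aA by linarith+
    have T: "T_star \<delta> k a * l\<^sup>2 = (1 + \<delta>)\<^sup>2 * ln a / (2 * a)"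
    proof -
      \<comment> \<open>This turns \<open>32 * k\<^sup>2\<close> into
        \<open>2 * a\<^sup>2 * l\<^sup>2\<close>, so that \<open>l\<close> disappears from the
        rescaled threshold.\<close>
      have k_eq: "k = a * l / 4"
        using a l by simp
      show ?thesis
        unfolding T_star_def k_eq using l a4(1) by (simp add: field_simps power2_eq_square)
    qed
    have "T_star \<delta> k a > 0"
      using assms k a4(1) by (simp add: T_star_def)
    then have t0: "t > 0"
      using t by simp
    have s: "(1 + \<delta>)\<^sup>2 * ln a / (2 * a) \<le> l\<^sup>2 * t"
      unfolding T[symmetric] using t by (simp add: mult.commute mult_right_mono)
    have "\<bar>u x t - u_infinity k x\<bar> \<le> 8 / (a powr (3 * \<delta> + \<delta>\<^sup>2) * sqrt t)" for x
    proof -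
      have "\<bar>u x t - u_infinity k x\<bar> \<le> l * (8 * a\<^sup>2 * exp (- 4 * (a - 1) * (l\<^sup>2 * t)))"
        by (rule burgers_tanh_estimate[OF l a a4(1) u t0 small_ratio[OF assms a4(2,1,3) s]])
      \<comment> \<open>The prefactor \<open>l\<close> cancels against
        \<open>sqrt (l\<^sup>2 * t)\<close>, which leaves the constant 8 independent of
        \<open>k\<close> and \<open>l\<close>.\<close>
      also have "\<dots> \<le> l * (8 / (a powr (3 * \<delta> + \<delta>\<^sup>2) * sqrt (l\<^sup>2 * t)))"
        using l by (intro mult_left_mono decay_estimate[OF assms a4(2,1) s]) auto
      also have "\<dots> = 8 / (a powr (3 * \<delta> + \<delta>\<^sup>2) * sqrt t)"
        using l by (simp add: real_sqrt_mult)
      finally show ?thesis .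
    qed
    then show "(SUP x. ereal \<bar>u x t - u_infinity k x\<bar>) \<le> ereal (8 / (a powr (3 * \<delta> + \<delta>\<^sup>2) * sqrt t))"
      by (intro SUP_least) simp
  qed
qed

end
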